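(* Let $0<\beta<1$, $n\ge1$, let $a_0,a_1,\dots,a_n$ be constants, and let $F$ be a continuous function on $[0,\infty)$ of exponential order. Let $z$ be the solution of the linear ordinary differential equation $$\sum_{k=1}^{n}a_k z^{(k)}(t)+a_0 z(t)=F(t),\qquad z^{(k)}(0)=z_k\ (k=0,\dots,n-1).$$ Suppose $z$ satisfies the hypotheses of Lemma 2 for every order $1,\dots,n$: $z,\dots,z^{(n)}$ are of exponential order, the iterated Caputo derivatives $(D_c^\beta)^k z_\beta$ ($k=1,\dots,n$) of $z_\beta(t)=\int_0^\infty z(s)g_\beta(s;t)\,ds$ exist, are continuous on $[0,\infty)$ and of exponential order, and $(D_c^\beta)^k z_\beta(0)=z^{(k)}(0)$ for $k=0,1,\dots,n$. Then $$y_\beta(t)=\int_0^\infty z(s)\,g_\beta(s;t)\,ds=\mathbb E\big[z(\mathcal T_\beta(t))\big]$$ solves the fractional differential equation $$\sum_{k=1}^{n}a_k\underbrace{D_c^\beta\cdots D_c^\beta}_{k\text{ times}}y_\beta(t)+a_0 y_\beta(t)=F_\beta(t),\qquad t>0,$$ where $F_\beta(t)=\int_0^\infty F(s)g_\beta(s;t)\,ds$, with initial conditions $(D_c^\beta)^k y_\beta(0)=z_k$ for $k=0,\dots,n-1$.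
   Context: For $0<\beta<1$, the Caputo derivative is $D_c^\beta h(t)=\frac{1}{\Gamma(1-\beta)}\int_0^t(t-\tau)^{-\beta}h'(\tau)\,d\tau$, and $(D_c^\beta)^k$ denotes its $k$-fold iterate ($(D_c^\beta)^0$ is the identity). The Wright-type function is $g_\beta(x;t)=\frac{1}{t^\beta}\sum_{k=0}^\infty\frac{(-x)^k}{t^{\beta k}\,k!\,\Gamma(1-\beta(k+1))}$ for $x\ge0,t>0$; for each $t>0$ it is the probability density of the random variable $\mathcal T_\beta(t)$, where $\mathcal T_\beta$ is the inverse of a $\beta$-stable subordinator. Its Laplace transform in $x$ is $E_\beta(-st^\beta)$, with $E_\beta(z)=\sum_{k\ge0}z^k/\Gamma(\beta k+1)$. The Wright-type transform of a function $h$ is $h_\beta(t)=\int_0^\infty g_\beta(s;t)h(s)\,ds$. *)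

theory Defs
  imports "HOL-Analysis.Analysis"
begin

text \<open>Value at t > 0 given by f; at t \<le> 0 (only t = 0 matters) the value is the
  right limit at 0, i.e. the continuous extension to [0,\<infinity>).\<close>
definition right_ext :: "(real \<Rightarrow> real) \<Rightarrow> real \<Rightarrow> real" where
  "right_ext f t = (if t > 0 then f t else Lim (at_right 0) f)"

definition caputo :: "real \<Rightarrow> (real \<Rightarrow> real) \<Rightarrow> real \<Rightarrow> real" where
  "caputo \<beta> h = right_ext (\<lambda>t. (1 / Gamma (1 - \<beta>)) *
      integral {0..t} (\<lambda>\<tau>. (t - \<tau>) powr (-\<beta>) * deriv h \<tau>))"

definition caputo_exists :: "real \<Rightarrow> (real \<Rightarrow> real) \<Rightarrow> bool" where
  "caputo_exists \<beta> h \<longleftrightarrow> (\<forall>t>0. (\<forall>\<tau>\<in>{0<..<t}. h differentiable (at \<tau>)) \<and>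
      (\<lambda>\<tau>. (t - \<tau>) powr (-\<beta>) * deriv h \<tau>) integrable_on {0..t})"

text \<open>Wright-type function g_beta(x;t); 1/Gamma is written with rGamma
  (which vanishes at the poles of Gamma).\<close>
definition wright_g :: "real \<Rightarrow> real \<Rightarrow> real \<Rightarrow> real" where
  "wright_g \<beta> x t = (1 / t powr \<beta>) *
     (\<Sum>k. (-x) ^ k * rGamma (1 - \<beta> * (real k + 1)) / (t powr (\<beta> * real k) * fact k))"

definition wright_transform :: "real \<Rightarrow> (real \<Rightarrow> real) \<Rightarrow> real \<Rightarrow> real" where
  "wright_transform \<beta> h = right_ext (\<lambda>t. integral {0..} (\<lambda>s. wright_g \<beta> s t * h s))"

definition exp_order :: "(real \<Rightarrow> real) \<Rightarrow> bool" where
  "exp_order f \<longleftrightarrow> (\<exists>M c T. \<forall>t\<ge>T. \<bar>f t\<bar> \<le> M * exp (c * t))"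

end

theory Submission
  imports Defs "HOL-Complex_Analysis.Cauchy_Integral_Theorem"
begin

text \<open>
  Write \<open>g(x; t) = t powr (-\<beta>) * M (x * t powr (-\<beta>))\<close>, so that the transform of \<open>h\<close> is
  \<open>u t = \<integral> M y * h (t powr \<beta> * y) dy\<close>. Hankel's integral for \<open>1 / \<Gamma>\<close> along a contour with
  vertex \<open>R > 0\<close> represents \<open>M\<close> by an absolutely convergent integral; letting \<open>R\<close> grow shows that
  \<open>M\<close> decays faster than every exponential, and Fubini gives its moments
  \<open>m! / \<Gamma> (1 + \<beta> m)\<close>. Differentiating under the integral sign, the Caputo derivative of \<open>u\<close>
  is an integral of \<open>h'\<close> against an explicit weight in \<open>(\<tau>, y)\<close>. By the Beta integral this weight
  has the same moments as the one defining the transform of \<open>h'\<close>, and for weights with all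
  exponential moments the moments determine the integrals of continuous functions of exponential
  order. Hence the Caputo derivative of the transform of \<open>h\<close> is the transform of \<open>h'\<close>, and
  iterating this carries the ordinary equation to the fractional one.
\<close>

subsection \<open>Integrals over the half-line\<close>

text \<open>The alternating power series of \<open>wright_M\<close> says nothing direct about its
  size at infinity, and without decay neither its moments nor the transform of an exponentially
  growing function is under control; this is what forces the detour through a contour integral. The
  sign of \<open>wright_M\<close> is never determined, so the uniqueness argument is set up for
  signed weights and asks only for absolute integrability against every exponential. Under that
  condition the moments fix the integrals of all exponentials: for \<open>wright_M\<close> these are
  the values of the Mittag-Leffler series with terms s^m / \<Gamma>(1 + \<beta> m). Comparing
  moments at one fixed t takes the place of the customary comparison of Laplace transforms in t.
  Differentiating h (s y) in the scale s brings down a factor y, which raises the moment index by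
  one; the Beta integral over \<tau> compensates exactly for this shift.\<close>

lemma exp_neg_tendsto:
  fixes a C :: real
  assumes "a > 0"
  shows "((\<lambda>r. C * exp (- a * r)) \<longlongrightarrow> 0) at_top"
proof -
  have "filterlim (\<lambda>r. - a * r) at_bot at_top"
    using assms by (intro filterlim_tendsto_neg_mult_at_bot[OF tendsto_const] filterlim_ident) auto
  then have "((\<lambda>r. C * exp (- a * r)) \<longlongrightarrow> C * 0) at_top"
    by (intro tendsto_intros filterlim_compose[OF exp_at_bot])
  then show ?thesis by simp
qed

lemma set_integrable_exp_neg:
  fixes a :: real
  assumes "a > 0"
  shows "set_integrable lborel {0..} (\<lambda>r. exp (- a * r))"
proof -
  have "(\<lambda>r. exp (- a * r)) absolutely_integrable_on {0..}"
    using integrable_on_exp_minus_to_infinity[OF assms, of 0]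
    by (intro nonnegative_absolutely_integrable_1) auto
  then show ?thesis
    unfolding absolutely_integrable_on_def set_integrable_def
    by (subst (asm) integrable_completion) auto
qed

lemma set_integrable_dominated_exp:
  fixes f :: "real \<Rightarrow> 'a::{banach, second_countable_topology}"
  assumes "continuous_on {0..} f" and "a > 0"
    and bound: "\<And>r. r \<ge> 0 \<Longrightarrow> norm (f r) \<le> C * exp (- a * r)"
  shows "set_integrable lborel {0..} f"
proof (rule set_integrable_bound[OF set_integrable_mult_right[OF set_integrable_exp_neg[OF assms(2)], of C]])
  show "set_borel_measurable lborel {0..} f"
    using borel_measurable_continuous_on_indicator[OF _ assms(1)]
    by (simp add: set_borel_measurable_def)
  show "AE x in lborel. x \<in> {0..} \<longrightarrow> norm (f x) \<le> norm (C * exp (- a * x))"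
    using bound by (force intro!: AE_I2 intro: order_trans[OF _ abs_ge_self])
qed

text \<open>Convergence of the primitive is a conclusion here, not an assumption. This matters for
  the contour argument, where nothing is known beforehand about the primitive at infinity.\<close>

lemma FTC_half_line_tendsto:
  fixes f F :: "real \<Rightarrow> 'a::euclidean_space"
  assumes deriv: "\<And>r. r \<ge> 0 \<Longrightarrow> (F has_vector_derivative f r) (at r within {0..})"
    and int: "set_integrable lborel {0..} f"
  shows "((\<lambda>b. F b - F 0) \<longlongrightarrow> (LINT r:{0..}|lborel. f r)) at_top"
proof (rule Lim_transform_eventually)
  show "((\<lambda>b. LINT r:{0..b}|lborel. f r) \<longlongrightarrow> (LINT r:{0..}|lborel. f r)) at_top"
    by (rule tendsto_set_lebesgue_integral_at_top[OF _ int]) auto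
  have "(LINT r:{0..b}|lborel. f r) = F b - F 0" if "b \<ge> 0" for b
  proof -
    have "set_integrable lborel {0..b} f"
      by (rule set_integrable_subset[OF int]) auto
    then have "(LINT r:{0..b}|lborel. f r) = integral {0..b} f"
      by (rule set_borel_integral_eq_integral(2))
    also have "\<dots> = F b - F 0"
      by (intro integral_unique fundamental_theorem_of_calculus that)
         (auto intro: has_vector_derivative_within_subset[OF deriv])
    finally show ?thesis .
  qed
  then show "\<forall>\<^sub>F b in at_top. (LINT r:{0..b}|lborel. f r) = F b - F 0"
    by (intro eventually_mono[OF eventually_ge_at_top[of 0]]) simp
qed

lemma set_integral_FTC_half_line:
  fixes f F :: "real \<Rightarrow> 'a::euclidean_space"
  assumes deriv: "\<And>r. r \<ge> 0 \<Longrightarrow> (F has_vector_derivative f r) (at r within {0..})"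
    and int: "set_integrable lborel {0..} f"
    and lim: "(F \<longlongrightarrow> L) at_top"
  shows "(LINT r:{0..}|lborel. f r) = L - F 0"
  by (rule tendsto_unique[OF trivial_limit_at_top_linorder FTC_half_line_tendsto[OF deriv int]
        tendsto_diff[OF lim tendsto_const]])

text \<open>Since \<beta> < 1, the logarithm of the left side is o(w), so any positive linear rate
  wins eventually; compactness covers the rest. The cutoff \<open>w0\<close> keeps w away from 0,
  where a negative power would blow up.\<close>

lemma powr_exp_powr_bound:
  fixes p z \<beta> a w0 :: real
  assumes "0 < \<beta>" "\<beta> < 1" "a > 0" "w0 > 0"
  obtains C where "C > 0" "\<And>w. w \<ge> w0 \<Longrightarrow> w powr p * exp (z * w powr \<beta>) \<le> C * exp (a * w)"
proof -
  define f where "f w = w powr p * exp (z * w powr \<beta>)" for w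
  have "((\<lambda>w. p * (ln w / w) + z * w powr (\<beta> - 1)) \<longlongrightarrow> p * 0 + z * 0) at_top"
    using assms by (intro tendsto_intros ln_x_over_x_tendsto_0 tendsto_neg_powr filterlim_ident) auto
  then have "\<forall>\<^sub>F w in at_top. p * (ln w / w) + z * w powr (\<beta> - 1) < a"
    using assms by (intro order_tendstoD(2)) auto
  then obtain b where b: "\<And>w. w \<ge> b \<Longrightarrow> p * (ln w / w) + z * w powr (\<beta> - 1) < a"
    by (auto simp: eventually_at_top_linorder)
  have "continuous_on {w0..b} f"
    using assms unfolding f_def by (intro continuous_intros) auto
  then have "bounded (f ` {w0..b})"
    by (intro compact_imp_bounded compact_continuous_image) auto
  then obtain D where D: "\<And>w. w \<in> {w0..b} \<Longrightarrow> \<bar>f w\<bar> \<le> D"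
    unfolding bounded_iff by (metis image_eqI real_norm_def)
  show thesis
  proof (rule that[of "max 1 D"])
    fix w assume w: "w \<ge> w0"
    then have w_pos: "w > 0" using assms by simp
    have "f w \<le> max 1 D * exp (a * w)"
    proof (cases "w \<ge> b")
      case True
      have "p * ln w + z * w powr \<beta> = w * (p * (ln w / w) + z * w powr (\<beta> - 1))"
        using w_pos by (simp add: powr_diff field_simps)
      also have "\<dots> \<le> a * w"
        using b[OF True] w_pos by simp
      finally have "exp (p * ln w + z * w powr \<beta>) \<le> exp (a * w)" by simp
      then have "f w \<le> 1 * exp (a * w)"
        using w_pos by (simp add: f_def powr_def exp_add)
      also have "\<dots> \<le> max 1 D * exp (a * w)" by (intro mult_right_mono) auto
      finally show ?thesis .
    next
      case False
      then have "f w \<le> max 1 D * 1" using D[of w] w by auto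
      also have "\<dots> \<le> max 1 D * exp (a * w)" 
        using w_pos assms by (intro mult_left_mono) auto
      finally show ?thesis .
    qed
    then show "w powr p * exp (z * w powr \<beta>) \<le> max 1 D * exp (a * w)"
      by (simp add: f_def)
  qed auto
qed

lemma integrable_product:
  fixes f :: "'a \<Rightarrow> real" and g :: "'b \<Rightarrow> real"
  assumes "sigma_finite_measure M" "sigma_finite_measure N"
    and f: "integrable M f" and g: "integrable N g"
  shows "integrable (M \<Otimes>\<^sub>M N) (\<lambda>(x, y). f x * g y)"
proof -
  interpret M: sigma_finite_measure M by fact
  interpret N: sigma_finite_measure N by fact
  interpret pair_sigma_finite M N ..
  have [measurable]: "f \<in> borel_measurable M" "g \<in> borel_measurable N"
    using f g by auto
  show ?thesis
  proof (rule Fubini_integrable)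
    have "integrable M (\<lambda>x. \<bar>f x\<bar> * (\<integral>y. \<bar>g y\<bar> \<partial>N))"
      using f by (intro integrable_mult_left integrable_abs)
    then show "integrable M (\<lambda>x. \<integral>y. norm (case (x, y) of (x, y) \<Rightarrow> f x * g y) \<partial>N)"
      by (simp add: abs_mult)
    show "AE x in M. integrable N (\<lambda>y. case (x, y) of (x, y) \<Rightarrow> f x * g y)"
      using g by (intro AE_I2) simp
  qed measurable
qed

subsection \<open>Hankel's integral for the reciprocal Gamma function\<close>

text \<open>Multiplication by -i turns the closed upper half-plane into the closed right half-plane,
  which meets the branch cut only at 0. In this form the logarithm is visibly continuous up to the
  negative axis, approached from above.\<close>

lemma Ln_upper_half_plane:
  assumes "Im s \<ge> 0" "s \<noteq> 0"
  shows "Ln s = Ln (- \<i> * s) + \<i> * of_real pi / 2"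
proof -
  have "Ln (\<i> * (- \<i> * s)) = Ln (- \<i> * s) + \<i> * of_real pi / 2"
    using assms by (subst Ln_times_ii) auto
  moreover have "\<i> * (- \<i> * s) = s" by simp
  ultimately show ?thesis by simp
qed

lemma continuous_on_powr_upper_half_plane:
  fixes p :: real
  assumes "p > 0"
  shows "continuous_on {s. Im s \<ge> 0} (\<lambda>s. s powr complex_of_real p)"
proof -
  have "continuous (at s within {s. Im s \<ge> 0}) (\<lambda>s. s powr complex_of_real p)" if s: "Im s \<ge> 0" for s
  proof (cases "s = 0")
    case True
    have "((\<lambda>x. norm x powr p) \<longlongrightarrow> 0) (at (0::complex) within {s. Im s \<ge> 0})"
      using assms by (intro tendsto_eq_intros tendsto_powr') auto
    then have "((\<lambda>x. norm (x powr complex_of_real p)) \<longlongrightarrow> 0) (at (0::complex) within {s. Im s \<ge> 0})"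
      by (simp add: norm_powr_real_powr')
    then show ?thesis
      using True assms by (simp add: continuous_within tendsto_norm_zero_iff)
  next
    case False
    have nr: "- \<i> * s \<notin> \<real>\<^sub>\<le>\<^sub>0"
      using s False by (auto simp: complex_nonpos_Reals_iff complex_eq_iff)
    have "continuous (at s within {s. Im s \<ge> 0})
        (\<lambda>s. exp (complex_of_real p * (Ln (- \<i> * s) + \<i> * of_real pi / 2)))"
      by (intro continuous_intros continuous_within_compose3[OF continuous_at_Ln] nr)
    then show ?thesis
    proof (rule continuous_transform_within[where \<delta> = "norm s"])
      fix x' assume "x' \<in> {s. Im s \<ge> 0}" "dist x' s < norm s"
      then show "exp (complex_of_real p * (Ln (- \<i> * x') + \<i> * of_real pi / 2)) = x' powr complex_of_real p"
        by (subst Ln_upper_half_plane[symmetric]) (auto simp: powr_def)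
    qed (use s False in auto)
  qed
  then show ?thesis by (simp add: continuous_on_eq_continuous_within)
qed

text \<open>An angle beyond \<pi>/2 sends the real part to minus infinity, so that exp decays along
  the ray; an angle below \<pi> keeps the ray off the negative axis and hence off the branch
  cut.\<close>

locale hankel_ray =
  fixes R \<theta> :: real
  assumes R_pos: "R > 0" and \<theta>_gt: "\<theta> > pi / 2" and \<theta>_lt: "\<theta> < pi"
begin

definition ray :: "real \<Rightarrow> complex" where
  "ray r = of_real R + of_real r * cis \<theta>"

text \<open>Half of Hankel's contour, traversed from its vertex \<open>R\<close>; by conjugation symmetry the
  other half contributes the same imaginary part.\<close>

definition hankel :: "(complex \<Rightarrow> complex) \<Rightarrow> real" where
  "hankel f = Im (LINT r:{0..}|lborel. cis \<theta> * f (ray r)) / pi"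

text \<open>Half of the rate at which exp decays along the ray. The other half is spent on absorbing
  powers and factors exp (z |s|^\<beta>).\<close>

definition decay :: real where "decay = - cos \<theta> / 2"

lemma sin_\<theta>_pos: "sin \<theta> > 0"
  using \<theta>_gt \<theta>_lt pi_gt_zero by (intro sin_gt_zero) linarith+

lemma cos_\<theta>_neg: "cos \<theta> < 0"
  using cos_monotone_0_pi[of "pi / 2" \<theta>] \<theta>_gt \<theta>_lt by simp

lemma decay_pos: "decay > 0"
  using cos_\<theta>_neg by (simp add: decay_def)

lemma Re_ray: "Re (ray r) = R - 2 * decay * r"
  and Im_ray: "Im (ray r) = r * sin \<theta>"
  by (simp_all add: ray_def decay_def)

lemma ray_0 [simp]: "ray 0 = of_real R"
  by (simp add: ray_def)

text \<open>\<open>R * sin \<theta>\<close> is the distance of the origin from the line carrying the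
  ray: rotation by -\<theta> makes that line horizontal.\<close>

lemma norm_ray_ge: "norm (ray r) \<ge> R * sin \<theta>"
proof -
  have "ray r * cis (- \<theta>) = of_real R * cis (- \<theta>) + of_real r"
    by (simp add: ray_def ring_distribs mult.assoc cis_mult)
  then have "Im (ray r * cis (- \<theta>)) = - (R * sin \<theta>)" by simp
  then have "R * sin \<theta> \<le> norm (ray r * cis (- \<theta>))"
    using abs_Im_le_cmod[of "ray r * cis (- \<theta>)"] by simp
  then show ?thesis by (simp add: norm_mult)
qed

lemma norm_ray_le: "r \<ge> 0 \<Longrightarrow> norm (ray r) \<le> R + r"
  unfolding ray_def using R_pos by (intro norm_triangle_le) (simp add: norm_mult)

lemma ray_not_nonpos: "r \<ge> 0 \<Longrightarrow> ray r \<notin> \<real>\<^sub>\<le>\<^sub>0"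
  using R_pos sin_\<theta>_pos by (auto simp: complex_nonpos_Reals_iff Re_ray Im_ray)

lemma ray_nonzero: "r \<ge> 0 \<Longrightarrow> ray r \<noteq> 0"
  using ray_not_nonpos by fastforce

lemma norm_exp_ray: "norm (exp (ray r)) = exp R * exp (- 2 * decay * r)"
  by (simp add: norm_exp_eq_Re Re_ray flip: exp_add)

lemma continuous_on_ray [continuous_intros]: "continuous_on A ray"
  unfolding ray_def by (intro continuous_intros)

lemma ray_has_vector_derivative: "(ray has_vector_derivative cis \<theta>) (at r within A)"
  unfolding ray_def by (auto intro!: derivative_eq_intros)

text \<open>The factor with \<open>z\<close> is included in order to dominate, later on, the partial
  sums of exp (- y s^\<beta>) along the ray.\<close>

lemma ray_bound:
  fixes p z \<beta> :: real
  assumes "0 < \<beta>" "\<beta> < 1"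
  obtains C where "C > 0"
    "\<And>r. r \<ge> 0 \<Longrightarrow> norm (exp (ray r)) * norm (ray r) powr p * exp (z * norm (ray r) powr \<beta>)
       \<le> C * exp (- decay * r)"
proof -
  obtain C where C: "C > 0"
    "\<And>w. w \<ge> R * sin \<theta> \<Longrightarrow> w powr p * exp (z * w powr \<beta>) \<le> C * exp (decay * w)"
    using powr_exp_powr_bound[OF assms decay_pos, of "R * sin \<theta>"] R_pos sin_\<theta>_pos
    by (metis mult_pos_pos)
  show thesis
  proof (rule that[of "exp R * C * exp (decay * R)"])
    fix r :: real assume r: "r \<ge> 0"
    have "norm (ray r) powr p * exp (z * norm (ray r) powr \<beta>) \<le> C * exp (decay * norm (ray r))"
      by (rule C(2)[OF norm_ray_ge])
    also have "\<dots> \<le> C * exp (decay * (R + r))"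
      using C(1) decay_pos norm_ray_le[OF r] by simp
    finally have "norm (exp (ray r)) * (norm (ray r) powr p * exp (z * norm (ray r) powr \<beta>))
        \<le> norm (exp (ray r)) * (C * exp (decay * (R + r)))"
      by (rule mult_left_mono) simp
    also have "\<dots> = (exp R * C * exp (decay * R)) * exp (- decay * r)"
    proof -
      have "exp (- 2 * decay * r) * exp (decay * (R + r)) = exp (decay * R) * exp (- decay * r)"
        unfolding mult_exp_exp by (rule arg_cong[of _ _ exp]) (simp add: algebra_simps)
      then show ?thesis
        unfolding norm_exp_ray by (simp add: mult_ac)
    qed
    finally show "norm (exp (ray r)) * norm (ray r) powr p * exp (z * norm (ray r) powr \<beta>)
        \<le> exp R * C * exp (decay * R) * exp (- decay * r)"
      by (simp add: mult.assoc)
  qed (use C(1) in simp)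
qed

lemma ray_bound_powr:
  fixes p :: real
  obtains C where "C > 0"
    "\<And>r. r \<ge> 0 \<Longrightarrow> norm (exp (ray r) * ray r powr of_real p) \<le> C * exp (- decay * r)"
proof -
  obtain C where "C > 0"
    "\<And>r. r \<ge> 0 \<Longrightarrow> norm (exp (ray r)) * norm (ray r) powr p * exp (0 * norm (ray r) powr (1/2))
       \<le> C * exp (- decay * r)"
    by (rule ray_bound[of "1/2" p 0]) auto
  then show thesis
    by (intro that[of C]) (auto simp: norm_mult norm_powr_real_powr' simp del: norm_exp_eq_Re)
qed

lemma continuous_on_ray_powr:
  fixes p :: complex
  shows "continuous_on {0..} (\<lambda>r. ray r powr p)"
proof -
  have "continuous_on {0..} (\<lambda>r. exp (p * Ln (ray r)))"
    using ray_not_nonpos by (intro continuous_intros) simp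
  then show ?thesis
    by (rule continuous_on_eq) (use ray_nonzero in \<open>simp add: powr_def\<close>)
qed

lemma ray_powr_integrable:
  "set_integrable lborel {0..} (\<lambda>r. cis \<theta> * (exp (ray r) * ray r powr of_real p))"
proof -
  obtain C where C: "\<And>r. r \<ge> 0 \<Longrightarrow> norm (exp (ray r) * ray r powr of_real p) \<le> C * exp (- decay * r)"
    using ray_bound_powr[of p] by blast
  show ?thesis
    by (rule set_integrable_dominated_exp[OF _ decay_pos, of _ C])
       (use C in \<open>auto intro!: continuous_intros continuous_on_ray_powr simp: norm_mult\<close>)
qed

text \<open>Integration by parts, in the form of the derivative of exp s * s^(-b) along the ray. The
  boundary term at the vertex is real because R > 0, so taking the imaginary part removes it. This
  is the recursion b * rGamma (b + 1) = rGamma b.\<close>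

lemma hankel_powr_step:
  "hankel (\<lambda>s. exp s * s powr of_real (- b)) = b * hankel (\<lambda>s. exp s * s powr of_real (- (b + 1)))"
proof -
  define h where "h b r = exp (ray r) * ray r powr of_real (- b)" for b r
  define I where "I = (\<lambda>b. LINT r:{0..}|lborel. cis \<theta> * h b r)"
  have int: "set_integrable lborel {0..} (\<lambda>r. cis \<theta> * h b r)" for b
    unfolding h_def by (rule ray_powr_integrable)
  have "(LINT r:{0..}|lborel. cis \<theta> * h b r - of_real b * (cis \<theta> * h (b + 1) r)) = 0 - h b 0"
  proof (rule set_integral_FTC_half_line)
    fix r :: real assume r: "r \<ge> 0"
    have "((\<lambda>s. exp s * s powr of_real (- b)) has_field_derivative
        (exp (ray r) * ray r powr of_real (- b) + exp (ray r) * (of_real (- b) * ray r powr (of_real (- b) - 1))))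
        (at (ray r))"
      using ray_not_nonpos[OF r] by (auto intro!: derivative_eq_intros)
    from field_vector_diff_chain_at[OF ray_has_vector_derivative this]
    have "(h b has_vector_derivative
       cis \<theta> * (exp (ray r) * ray r powr of_real (- b) + exp (ray r) * (of_real (- b) * ray r powr (of_real (- b) - 1)))) (at r)"
      by (simp add: o_def h_def[abs_def])
    moreover have "of_real (- b) - 1 = complex_of_real (- (b + 1))" by simp
    ultimately have "(h b has_vector_derivative
       cis \<theta> * (h b r + exp (ray r) * (of_real (- b) * ray r powr complex_of_real (- (b + 1))))) (at r)"
      unfolding h_def[abs_def] by metis
    moreover have "cis \<theta> * (h b r + exp (ray r) * (of_real (- b) * ray r powr complex_of_real (- (b + 1))))
        = cis \<theta> * h b r - of_real b * (cis \<theta> * h (b + 1) r)"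
      unfolding h_def[of "b + 1" r] by (simp only: of_real_minus ring_distribs mult_minus_left mult_minus_right mult_ac diff_conv_add_uminus)
    ultimately show "(h b has_vector_derivative
        cis \<theta> * h b r - of_real b * (cis \<theta> * h (b + 1) r)) (at r within {0..})"
      by (metis has_vector_derivative_at_within)
  next
    show "set_integrable lborel {0..} (\<lambda>r. cis \<theta> * h b r - of_real b * (cis \<theta> * h (b + 1) r))"
      by (intro set_integral_diff set_integrable_mult_right int)
  next
    obtain C where C: "\<And>r. r \<ge> 0 \<Longrightarrow> norm (exp (ray r) * ray r powr of_real (- b)) \<le> C * exp (- decay * r)"
      using ray_bound_powr[of "- b"] by blast
    show "(h b \<longlongrightarrow> 0) at_top"
    proof (rule Lim_null_comparison[OF _ exp_neg_tendsto[OF decay_pos, of C]])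
      show "\<forall>\<^sub>F r in at_top. norm (h b r) \<le> C * exp (- decay * r)"
        unfolding h_def by (rule eventually_mono[OF eventually_ge_at_top[of 0]]) (rule C)
    qed
  qed
  also have "(LINT r:{0..}|lborel. cis \<theta> * h b r - of_real b * (cis \<theta> * h (b + 1) r))
       = I b - of_real b * I (b + 1)"
    unfolding I_def using int
    by (subst set_integral_diff) (simp_all only: set_integral_mult_right set_integrable_mult_right simp_thms)
  finally have "Im (I b) = b * Im (I (b + 1)) - Im (h b 0)"
    by (simp add: complex_eq_iff)
  moreover have "h b 0 = of_real (exp R * R powr (- b))"
    using R_pos unfolding h_def by (simp only: ray_0 powr_of_real exp_of_real of_real_mult less_imp_le)
  ultimately have "Im (I b) = b * Im (I (b + 1))"
    by (metis Im_complex_of_real diff_zero)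
  then show ?thesis
    unfolding hankel_def I_def h_def by (simp only: times_divide_eq_right)
qed

text \<open>A primitive \<open>P\<close> of the integrand on the closed upper half-plane replaces contour
  integration: \<open>Im P\<close> is constant on the positive axis, its increment along the negative axis is
  a Gamma integral, and the ray and the negative axis have the same limit at infinity.\<close>

lemma hankel_powr_pos:
  fixes p :: real
  assumes p: "p > 0"
  shows "hankel (\<lambda>s. exp s * s powr of_real p) = - sin (pi * p) * Gamma (p + 1) / pi"
proof -
  define H :: "complex set" where "H = {s. Im s \<ge> 0}"
  define F where "F s = exp s * s powr complex_of_real p" for s
  define I where "I = (LINT r:{0..}|lborel. cis \<theta> * F (ray r))"
  have convex_H: "convex H"
    unfolding H_def by (rule convex_halfspace_Im_ge)
  \<comment> \<open>Positivity of p enters here: F stays continuous at the branch point 0, so the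
    primitive can be taken on all of H without indenting the path.\<close>
  have cont_F: "continuous_on H F"
    unfolding F_def H_def by (intro continuous_intros continuous_on_powr_upper_half_plane p)
  have interior_H: "interior H = {s. Im s > 0}"
    using interior_halfspace_ge[of "\<i>" 0] by (simp add: H_def inner_complex_def)
  have "F field_differentiable at s" if "s \<in> interior H - {}" for s
  proof -
    have "s \<notin> \<real>\<^sub>\<le>\<^sub>0" using that by (auto simp: interior_H complex_nonpos_Reals_iff)
    then show ?thesis
      unfolding F_def field_differentiable_def by (auto intro!: derivative_eq_intros exI)
  qed
  then obtain P where P: "\<And>s. s \<in> H \<Longrightarrow> (P has_field_derivative F s) (at s within H)"
    using holomorphic_convex_primitive[OF convex_H finite.emptyI cont_F] by metis
  define q where "q x = Im (P (of_real x))" for x :: real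
  \<comment> \<open>The real axis is the boundary of H, where P is differentiable only within H;
    restricted to the axis this still gives a two-sided real derivative.\<close>
  have q_deriv: "(q has_real_derivative Im (F (of_real x))) (at x within A)" for x A
  proof -
    have "(P has_field_derivative F (of_real x)) (at (of_real x) within range of_real)"
      by (rule DERIV_subset[OF P]) (auto simp: H_def)
    from field_vector_diff_chain_within[OF has_vector_derivative_of_real[OF DERIV_ident] this]
    have "((\<lambda>x. P (of_real x)) has_vector_derivative F (of_real x)) (at x)"
      by (simp add: o_def)
    then have "((\<lambda>x. Im (P (of_real x))) has_real_derivative Im (F (of_real x))) (at x)"
      by (simp only: has_vector_derivative_complex_iff)
    then show ?thesis
      unfolding q_def by (rule has_field_derivative_at_within)
  qed
  have Im_F_pos: "Im (F (of_real x)) = 0" if "x \<ge> 0" for x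
    using that by (cases "x = 0") (auto simp: F_def powr_of_real exp_of_real)
  \<comment> \<open>On the negative axis Ln takes its value from above, with argument \<pi>, which
    produces the factor exp (i \<pi> p) and hence the sine of the reflection formula.\<close>
  have Im_F_neg: "Im (F (of_real (- x))) = sin (pi * p) * (x powr p / exp x)" if "x \<ge> 0" for x
  proof (cases "x = 0")
    case False
    then have "Ln (of_real (- x)) = of_real (ln x) + of_real pi * \<i>"
      using that by (subst Ln_of_real') auto
    then have "of_real (- x) powr complex_of_real p = exp (of_real (p * ln x) + \<i> * of_real (pi * p))"
      using False by (simp add: powr_def algebra_simps)
    also have "\<dots> = of_real (x powr p) * cis (pi * p)"
      using False that by (simp only: exp_add powr_def cis_conv_exp exp_of_real if_False)
    finally have F_eq: "F (of_real (- x)) = of_real (exp (- x) * x powr p) * cis (pi * p)"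
      unfolding F_def by (simp only: exp_of_real of_real_mult mult.assoc)
    show ?thesis unfolding F_eq by (simp add: exp_minus field_simps)
  qed (auto simp: F_def)
  have G: "((\<lambda>r. r powr p / exp r) has_integral Gamma (p + 1)) {0..}"
    using Gamma_integral_real[of "p + 1"] p by simp
  then have "(\<lambda>r. r powr p / exp r) absolutely_integrable_on {0..}"
    by (intro nonnegative_absolutely_integrable_1) auto
  then have Gamma_set_int: "set_integrable lborel {0..} (\<lambda>r. r powr p / exp r)"
    unfolding absolutely_integrable_on_def set_integrable_def
    by (subst (asm) integrable_completion) auto
  have "q R = q 0"
    by (rule has_field_derivative_zero_constant[of "{0..R}" q, THEN exE])
       (use R_pos Im_F_pos q_deriv in \<open>auto intro!: q_deriv[THEN DERIV_cong]\<close>)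
  moreover have "((\<lambda>N. q (- N) - q (- 0)) \<longlongrightarrow> (LINT r:{0..}|lborel. - sin (pi * p) * (r powr p / exp r))) at_top"
  proof (rule FTC_half_line_tendsto)
    fix r :: real assume r: "r \<ge> 0"
    have "((\<lambda>r. q (- r)) has_real_derivative Im (F (of_real (- r))) * - 1) (at r within {0..})"
      by (rule DERIV_chain2[OF q_deriv]) (auto intro!: derivative_eq_intros)
    then show "((\<lambda>r. q (- r)) has_vector_derivative - sin (pi * p) * (r powr p / exp r)) (at r within {0..})"
      unfolding Im_F_neg[OF r] by (simp add: has_real_derivative_iff_has_vector_derivative)
  next
    show "set_integrable lborel {0..} (\<lambda>r. - sin (pi * p) * (r powr p / exp r))"
      by (intro set_integrable_mult_right Gamma_set_int)
  qed
  moreover have "(LINT r:{0..}|lborel. - sin (pi * p) * (r powr p / exp r)) = - sin (pi * p) * Gamma (p + 1)"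
  proof -
    from set_borel_integral_eq_integral(2)[OF Gamma_set_int] integral_unique[OF G]
    have "(LINT r:{0..}|lborel. r powr p / exp r) = Gamma (p + 1)" by simp
    then show ?thesis
      using set_integral_mult_right[of lborel "{0..}" "- sin (pi * p)" "\<lambda>r. r powr p / exp r"] by simp
  qed
  ultimately have 1: "((\<lambda>N. q (- N) - q R) \<longlongrightarrow> - sin (pi * p) * Gamma (p + 1)) at_top"
    by simp
  have ray_in_H: "ray r \<in> H" if "r \<ge> 0" for r
    using that sin_\<theta>_pos by (simp add: H_def Im_ray)
  have "((\<lambda>N. P (ray N) - P (ray 0)) \<longlongrightarrow> I) at_top"
    unfolding I_def
  proof (rule FTC_half_line_tendsto)
    fix r :: real assume r: "r \<ge> 0"
    have "(P has_field_derivative F (ray r)) (at (ray r) within ray ` {0..})"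
      by (rule DERIV_subset[OF P]) (use ray_in_H r in auto)
    from field_vector_diff_chain_within[OF ray_has_vector_derivative this]
    show "((\<lambda>r. P (ray r)) has_vector_derivative cis \<theta> * F (ray r)) (at r within {0..})"
      by (simp add: o_def)
  qed (unfold F_def, rule ray_powr_integrable)
  then have 2: "((\<lambda>N. Im (P (ray N)) - q R) \<longlongrightarrow> Im I) at_top"
    unfolding q_def by (auto dest: tendsto_Im)
  \<comment> \<open>One power more than in F: the extra one pays for the length of the segment
    joining the two curves. The \<beta>-factor of the bound is switched off by taking its
    coefficient 0.\<close>
  obtain C where C: "C > 0" "\<And>w. w \<ge> R \<Longrightarrow> w powr (p + 1) * exp (0 * w powr (1/2)) \<le> C * exp (decay * w)"
    by (rule powr_exp_powr_bound[of "1/2" decay R "p + 1" 0]) (use R_pos decay_pos in auto)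
  have "((\<lambda>N. P (ray N) - P (of_real (- N))) \<longlongrightarrow> 0) at_top"
  proof (rule Lim_null_comparison[OF _ exp_neg_tendsto[OF decay_pos]])
    have "norm (P (ray N) - P (of_real (- N))) \<le> (2 * exp R * C * exp (decay * R)) * exp (- decay * N)"
      if N: "N \<ge> 0" for N
    proof -
      \<comment> \<open>A convex set containing both endpoints on which |F| is small: the half-plane
        condition bounds exp, the ball bounds the power. The point -N belongs to it because - cos
        \<theta> \<le> 1.\<close>
      define S where "S = H \<inter> {s. Re s \<le> R - 2 * decay * N} \<inter> cball 0 (R + N)"
      have "norm (P (ray N) - P (of_real (- N))) \<le>
          (exp (R - 2 * decay * N) * (R + N) powr p) * norm (ray N - of_real (- N))"
      proof (rule field_differentiable_bound)
        show "convex S"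
          unfolding S_def by (intro convex_Int convex_H convex_halfspace_Re_le convex_cball)
        show "(P has_field_derivative F s) (at s within S)" if "s \<in> S" for s
          by (rule DERIV_subset[OF P]) (use that in \<open>auto simp: S_def\<close>)
        show "norm (F s) \<le> exp (R - 2 * decay * N) * (R + N) powr p" if "s \<in> S" for s
          using that p unfolding F_def norm_mult
          by (intro mult_mono) (auto simp: S_def norm_powr_real_powr' intro!: powr_mono2)
        show "ray N \<in> S"
          using ray_in_H N norm_ray_le by (simp add: S_def Re_ray)
        have "2 * decay \<le> 1" using cos_ge_minus_one[of \<theta>] by (simp add: decay_def)
        then have "2 * decay * N \<le> 1 * N" using N by (intro mult_right_mono)
        then show "of_real (- N) \<in> S"
          using R_pos N by (simp add: S_def H_def)
      qed
      also have "\<dots> \<le> (exp (R - 2 * decay * N) * (R + N) powr p) * (2 * (R + N))"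
        using norm_triangle_ineq4[of "ray N" "of_real (- N)"] norm_ray_le[OF N] N R_pos
        by (intro mult_left_mono) auto
      also have "\<dots> = 2 * exp (R - 2 * decay * N) * (R + N) powr (p + 1)"
        using R_pos N by (simp add: powr_add)
      also have "\<dots> \<le> 2 * exp (R - 2 * decay * N) * (C * exp (decay * (R + N)))"
        using C(2)[of "R + N"] N R_pos by (intro mult_left_mono) auto
      also have "\<dots> = 2 * C * (exp (R - 2 * decay * N) * exp (decay * (R + N)))" by simp
      also have "exp (R - 2 * decay * N) * exp (decay * (R + N))
          = exp R * exp (decay * R) * exp (- decay * N)"
        unfolding mult_exp_exp by (rule arg_cong[of _ _ exp]) (simp add: algebra_simps)
      finally show ?thesis by (simp add: mult_ac)
    qed
    then show "\<forall>\<^sub>F N in at_top. norm (P (ray N) - P (of_real (- N)))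
        \<le> (2 * exp R * C * exp (decay * R)) * exp (- decay * N)"
      by (intro eventually_mono[OF eventually_ge_at_top[of 0]])
  qed
  then have "((\<lambda>N. Im (P (ray N)) - q (- N)) \<longlongrightarrow> 0) at_top"
    unfolding q_def by (auto dest: tendsto_Im)
  from tendsto_add[OF this 1] have "((\<lambda>N. Im (P (ray N)) - q R) \<longlongrightarrow> - sin (pi * p) * Gamma (p + 1)) at_top"
    by simp
  from tendsto_unique[OF _ 2 this] have "Im I = - sin (pi * p) * Gamma (p + 1)" by simp
  then show ?thesis
    unfolding hankel_def I_def F_def by simp
qed

text \<open>For b < 0 the value found with p = - b is rGamma b in disguise, by the reflection
  formula. One use of the recursion, from b - 1 < 0, then reaches every b < 1 without dividing by
  zero.\<close>

lemma hankel_powr_lt_1: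
  assumes "b < 1"
  shows "hankel (\<lambda>s. exp s * s powr of_real (- b)) = rGamma b"
proof -
  have neg: "hankel (\<lambda>s. exp s * s powr of_real (- b)) = rGamma b" if b: "b < 0" for b
  proof -
    have "complex_of_real (rGamma b * rGamma (1 - b)) = rGamma (of_real b) * rGamma (1 - of_real b)"
      using rGamma_complex_of_real[of "1 - b"] by (simp add: rGamma_complex_of_real)
    also have "\<dots> = sin (of_real (pi * b)) / of_real pi"
      by (simp add: rGamma_reflection_complex)
    also have "\<dots> = of_real (sin (pi * b) / pi)"
      by (simp only: sin_of_real of_real_divide)
    finally have "complex_of_real (rGamma b * rGamma (1 - b)) = of_real (sin (pi * b) / pi)" .
    then have "rGamma b * rGamma (1 - b) = sin (pi * b) / pi"
      by (simp only: of_real_eq_iff)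
    moreover have "Gamma (1 - b) > 0" using b by simp
    moreover have "rGamma (1 - b) = 1 / Gamma (1 - b)"
      by (simp add: rGamma_inverse_Gamma inverse_eq_divide)
    ultimately have "rGamma b = sin (pi * b) * Gamma (1 - b) / pi"
      by (simp add: divide_eq_eq eq_divide_eq)
    then show ?thesis
      using hankel_powr_pos[of "- b"] b by (simp add: add.commute)
  qed
  have "(b - 1) * hankel (\<lambda>s. exp s * s powr of_real (- b)) = rGamma (b - 1)"
    using hankel_powr_step[of "b - 1"] neg[of "b - 1"] assms by simp
  also have "\<dots> = (b - 1) * rGamma b"
    using rGamma_plus1[of "b - 1"] by simp
  finally show ?thesis using assms by simp
qed

text \<open>The recursion degenerates when it leads from \<open>b = 0\<close> to \<open>b = 1\<close>; the value there is
  recovered by continuity.\<close>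

lemma hankel_powr_1: "hankel (\<lambda>s. exp s * s powr of_real (- 1)) = 1"
proof -
  define b where "b n = inverse (real (Suc (Suc n)))" for n
  define c where "c n = - (b n + 1)" for n
  have b: "b n > 0" "b n < 1" for n
    by (auto simp: b_def field_simps)
  have "b \<longlonglongrightarrow> 0" unfolding b_def
    by (rule LIMSEQ_Suc[OF LIMSEQ_inverse_real_of_nat])
  then have c_lim: "c \<longlonglongrightarrow> - (0 + 1)" unfolding c_def by (intro tendsto_intros)
  have "(\<lambda>n. LINT r:{0..}|lborel. cis \<theta> * (exp (ray r) * ray r powr of_real (c n)))
     \<longlonglongrightarrow> (LINT r:{0..}|lborel. cis \<theta> * (exp (ray r) * ray r powr of_real (- 1)))"
    unfolding set_lebesgue_integral_def
  proof (rule integral_dominated_convergence)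
    fix n
    show "(\<lambda>r. indicator {0..} r *\<^sub>R (cis \<theta> * (exp (ray r) * ray r powr of_real (c n)))) \<in> borel_measurable lborel"
      using ray_powr_integrable unfolding set_integrable_def by (intro borel_measurable_integrable)
    \<comment> \<open>The exponents lie between -2 and -1, so whichever side of 1 the modulus is on,
      one of the two extreme powers dominates. This gives a majorant independent of n.\<close>
    have "norm (ray r) powr c n \<le> norm (ray r) powr - 1 + norm (ray r) powr - 2" if "r \<ge> 0" for r
    proof (cases "norm (ray r) \<ge> 1")
      case True
      then show ?thesis using b[of n] by (intro add_increasing2 powr_mono) (auto simp: c_def)
    next
      case False
      then show ?thesis using b[of n] by (intro add_increasing powr_mono') (auto simp: c_def)
    qed
    from mult_left_mono[OF this, of _ "norm (exp (ray _))"]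
    show "AE r in lborel. norm (indicator {0..} r *\<^sub>R (cis \<theta> * (exp (ray r) * ray r powr of_real (c n))))
      \<le> norm (indicator {0..} r *\<^sub>R (cis \<theta> * (exp (ray r) * ray r powr of_real (- 1))))
        + norm (indicator {0..} r *\<^sub>R (cis \<theta> * (exp (ray r) * ray r powr of_real (- 2))))"
      by (intro AE_I2) (auto simp: indicator_def norm_mult norm_powr_real_powr' ring_distribs
            simp del: norm_exp_eq_Re of_real_minus)
  next
    show "AE r in lborel. (\<lambda>n. indicator {0..} r *\<^sub>R (cis \<theta> * (exp (ray r) * ray r powr of_real (c n))))
        \<longlonglongrightarrow> indicator {0..} r *\<^sub>R (cis \<theta> * (exp (ray r) * ray r powr of_real (- 1)))"
    proof (intro AE_I2)
      fix r
      show "(\<lambda>n. indicator {0..} r *\<^sub>R (cis \<theta> * (exp (ray r) * ray r powr of_real (c n))))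
        \<longlonglongrightarrow> indicator {0..} r *\<^sub>R (cis \<theta> * (exp (ray r) * ray r powr of_real (- 1)))"
      proof (cases "r \<ge> 0")
        case True
        have "(\<lambda>n. exp (of_real (c n) * Ln (ray r))) \<longlonglongrightarrow> exp (of_real (- 1) * Ln (ray r))"
          using c_lim by (intro tendsto_intros) simp
        then have "(\<lambda>n. ray r powr of_real (c n)) \<longlonglongrightarrow> ray r powr of_real (- 1)"
          using ray_nonzero[OF True] by (simp only: powr_def if_False)
        then show ?thesis
          by (intro tendsto_scaleR tendsto_mult tendsto_const)
      qed simp
    qed
  next
    show "(\<lambda>r. indicator {0..} r *\<^sub>R (cis \<theta> * (exp (ray r) * ray r powr of_real (- 1)))) \<in> borel_measurable lborel"
      using ray_powr_integrable unfolding set_integrable_def by (intro borel_measurable_integrable)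
    show "integrable lborel (\<lambda>r. norm (indicator {0..} r *\<^sub>R (cis \<theta> * (exp (ray r) * ray r powr of_real (- 1))))
        + norm (indicator {0..} r *\<^sub>R (cis \<theta> * (exp (ray r) * ray r powr of_real (- 2)))))"
      using ray_powr_integrable unfolding set_integrable_def
      by (intro Bochner_Integration.integrable_add integrable_norm)
  qed
  then have "(\<lambda>n. hankel (\<lambda>s. exp s * s powr of_real (c n))) \<longlonglongrightarrow> hankel (\<lambda>s. exp s * s powr of_real (- 1))"
    unfolding hankel_def by (intro tendsto_intros) simp_all
  moreover have "hankel (\<lambda>s. exp s * s powr of_real (c n)) = rGamma (b n + 1)" for n
  proof -
    \<comment> \<open>The recursion at a strictly positive \<open>b n\<close> may be cancelled; only
      its limit case b = 0 carries no information.\<close>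
    have "b n * hankel (\<lambda>s. exp s * s powr of_real (c n)) = b n * rGamma (b n + 1)"
      using hankel_powr_step[of "b n"] hankel_powr_lt_1[OF b(2)] rGamma_plus1[of "b n"]
      unfolding c_def by metis
    then show ?thesis using b(1)[of n] by (metis less_irrefl mult_left_cancel)
  qed
  moreover have "(\<lambda>n. rGamma (b n + 1)) \<longlonglongrightarrow> rGamma (0 + 1)"
    using \<open>b \<longlonglongrightarrow> 0\<close>
    by (intro isCont_tendsto_compose[where g = rGamma] tendsto_intros continuous_intros)
  ultimately show ?thesis using LIMSEQ_unique by fastforce
qed

text \<open>Both sides satisfy (b - 1) f(b) = f(b - 1), so the identity moves one unit to the right
  at a time, except at b = 1, where \<open>hankel_powr_1\<close> steps in.\<close>

lemma hankel_rGamma: "hankel (\<lambda>s. exp s * s powr of_real (- b)) = rGamma b"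
proof -
  have "b < 1 + real n \<Longrightarrow> hankel (\<lambda>s. exp s * s powr of_real (- b)) = rGamma b" for n
  proof (induction n arbitrary: b)
    case 0
    then show ?case by (simp add: hankel_powr_lt_1 del: of_real_minus)
  next
    case (Suc n)
    show ?case
    proof (cases "b = 1")
      case True
      then show ?thesis using hankel_powr_1 by simp
    next
      case False
      have "(b - 1) * hankel (\<lambda>s. exp s * s powr of_real (- b)) = rGamma (b - 1)"
        using hankel_powr_step[of "b - 1"] Suc.IH[of "b - 1"] Suc.prems by simp
      also have "\<dots> = (b - 1) * rGamma b"
        using rGamma_plus1[of "b - 1"] by simp
      finally show ?thesis using False by simp
    qed
  qed
  moreover obtain n where "b < 1 + real n"
    by (metis add.commute less_add_one order.strict_trans reals_Archimedean2)
  ultimately show ?thesis by blast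
qed

end

section \<open>Laplace integrals of powers with complex parameter\<close>

lemma power_le_exp:
  fixes y a :: real
  assumes "a > 0" "y \<ge> 0"
  shows "y ^ m \<le> fact m / a ^ m * exp (a * y)"
proof -
  have "(a * y) ^ m / fact m \<le> exp (a * y)"
  proof -
    have "(\<Sum>k\<in>{m}. (a * y) ^ k /\<^sub>R fact k) \<le> (\<Sum>k. (a * y) ^ k /\<^sub>R fact k)"
      using assms by (intro sum_le_suminf summable_exp_generic) auto
    then show ?thesis by (simp add: exp_def divide_inverse mult.commute)
  qed
  then show ?thesis using assms by (simp add: field_simps power_mult_distrib)
qed

lemma sum_power_le_exp:
  fixes x :: real
  assumes "x \<ge> 0"
  shows "(\<Sum>k<n. x ^ k / fact k) \<le> exp x"
proof -
  have "(\<Sum>k<n. x ^ k /\<^sub>R fact k) \<le> (\<Sum>k. x ^ k /\<^sub>R fact k)"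
    using assms by (intro sum_le_suminf summable_exp_generic) auto
  then show ?thesis by (simp add: exp_def divide_inverse mult.commute)
qed

text \<open>Half of the decay rate \<open>Re w\<close> is traded against the power of y, leaving an
  integrable exponential.\<close>

lemma norm_laplace_power_le:
  fixes w :: complex
  assumes "Re w > 0" "y \<ge> 0"
  shows "norm (of_real y ^ m * exp (- (of_real y * w))) \<le> fact m / (Re w / 2) ^ m * exp (- (Re w / 2) * y)"
proof -
  have "norm (of_real y ^ m * exp (- (of_real y * w))) = y ^ m * exp (- (y * Re w))"
    using assms by (simp add: norm_mult norm_power)
  also have "\<dots> \<le> (fact m / (Re w / 2) ^ m * exp (Re w / 2 * y)) * exp (- (y * Re w))"
    using assms by (intro mult_right_mono power_le_exp) auto
  also have "\<dots> = fact m / (Re w / 2) ^ m * (exp (Re w / 2 * y) * exp (- (y * Re w)))"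
    by simp
  also have "exp (Re w / 2 * y) * exp (- (y * Re w)) = exp (- (Re w / 2) * y)"
    unfolding mult_exp_exp by (rule arg_cong[of _ _ exp]) (simp add: field_simps)
  finally show ?thesis .
qed

lemma laplace_power_integrable:
  fixes w :: complex
  assumes "Re w > 0"
  shows "set_integrable lborel {0..} (\<lambda>y. of_real y ^ m * exp (- (of_real y * w)))"
  by (rule set_integrable_dominated_exp[OF _ _ norm_laplace_power_le[OF assms]])
     (use assms in \<open>auto intro!: continuous_intros\<close>)

lemma laplace_power_tendsto:
  fixes w :: complex
  assumes "Re w > 0"
  shows "((\<lambda>y. of_real y ^ m * exp (- (of_real y * w))) \<longlongrightarrow> 0) at_top"
proof (rule Lim_null_comparison[OF _ exp_neg_tendsto])
  show "\<forall>\<^sub>F y in at_top. norm (of_real y ^ m * exp (- (of_real y * w)))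
      \<le> fact m / (Re w / 2) ^ m * exp (- (Re w / 2) * y)"
    by (rule eventually_mono[OF eventually_ge_at_top[of 0]]) (rule norm_laplace_power_le[OF assms])
qed (use assms in simp)

lemma laplace_power:
  fixes w :: complex
  assumes "Re w > 0"
  shows "(LINT y:{0..}|lborel. of_real y ^ m * exp (- (of_real y * w))) = fact m / w ^ Suc m"
proof -
  have w: "w \<noteq> 0" using assms by auto
  define I where "I m = (LINT y:{0..}|lborel. of_real y ^ m * exp (- (of_real y * w)))" for m
  \<comment> \<open>For m = 0 the truncated exponent \<open>m - 1\<close> is harmless, since its
    coefficient is 0.\<close>
  have deriv: "((\<lambda>y. of_real y ^ m * exp (- (of_real y * w))) has_vector_derivative
      (of_nat m * of_real y ^ (m - 1) * exp (- (of_real y * w)) - w * (of_real y ^ m * exp (- (of_real y * w)))))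
      (at y within {0..})" for m and y :: real
  proof -
    have "((\<lambda>s. s ^ m * exp (- (s * w))) has_field_derivative
      (of_nat m * of_real y ^ (m - 1) * exp (- (of_real y * w)) - w * (of_real y ^ m * exp (- (of_real y * w)))))
      (at (of_real y))"
      by (auto intro!: derivative_eq_intros simp: mult_ac)
    from field_vector_diff_chain_at[OF has_vector_derivative_of_real[OF DERIV_ident] this]
    show ?thesis by (auto simp: o_def intro: has_vector_derivative_at_within)
  qed
  have "I m = fact m / w ^ Suc m"
  proof (induction m)
    case 0
    have "(LINT y:{0..}|lborel. - (w * (of_real y ^ 0 * exp (- (of_real y * w))))) = 0 - (of_real 0 ^ 0 * exp (- (of_real 0 * w)))"
    proof (rule set_integral_FTC_half_line[OF _ _ laplace_power_tendsto[OF assms]])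
      show "((\<lambda>y. of_real y ^ 0 * exp (- (of_real y * w))) has_vector_derivative
        - (w * (of_real y ^ 0 * exp (- (of_real y * w))))) (at y within {0..})" for y
        using deriv[of 0 y] by simp
      show "set_integrable lborel {0..} (\<lambda>y. - (w * (of_real y ^ 0 * exp (- (of_real y * w)))))"
        using set_integrable_mult_right[OF laplace_power_integrable[OF assms, of 0], of "- w"] by simp
    qed
    also have "(LINT y:{0..}|lborel. - (w * (of_real y ^ 0 * exp (- (of_real y * w))))) = - w * I 0"
      unfolding I_def by (subst set_integral_mult_right[symmetric]) simp
    finally show ?case using w by (simp add: field_simps)
  next
    case (Suc m)
    have "(LINT y:{0..}|lborel. of_nat (Suc m) * (of_real y ^ m * exp (- (of_real y * w)))
          - w * (of_real y ^ Suc m * exp (- (of_real y * w))))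
        = 0 - of_real 0 ^ Suc m * exp (- (of_real 0 * w))"
    proof (rule set_integral_FTC_half_line[OF _ _ laplace_power_tendsto[OF assms]])
      show "((\<lambda>y. of_real y ^ Suc m * exp (- (of_real y * w))) has_vector_derivative
        of_nat (Suc m) * (of_real y ^ m * exp (- (of_real y * w)))
          - w * (of_real y ^ Suc m * exp (- (of_real y * w)))) (at y within {0..})" for y
        using deriv[of "Suc m" y] by (simp only: diff_Suc_1 mult.assoc)
      show "set_integrable lborel {0..} (\<lambda>y. of_nat (Suc m) * (of_real y ^ m * exp (- (of_real y * w)))
          - w * (of_real y ^ Suc m * exp (- (of_real y * w))))"
        by (intro set_integral_diff set_integrable_mult_right laplace_power_integrable assms)
    qed
    also have "(LINT y:{0..}|lborel. of_nat (Suc m) * (of_real y ^ m * exp (- (of_real y * w)))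
          - w * (of_real y ^ Suc m * exp (- (of_real y * w)))) = of_nat (Suc m) * I m - w * I (Suc m)"
      unfolding I_def
      by (subst set_integral_diff)
         (simp_all only: set_integral_mult_right set_integrable_mult_right laplace_power_integrable assms simp_thms)
    finally have "w * I (Suc m) = of_nat (Suc m) * I m" by simp
    then show ?case using w unfolding Suc.IH by (simp add: field_simps)
  qed
  then show ?thesis by (simp add: I_def)
qed

subsection \<open>The Wright function\<close>

text \<open>The M-Wright (Mainardi) function, the profile of the self-similar family
  \<open>wright_g\<close>; it coincides with \<open>wright_g\<close> at t = 1.\<close>

definition wright_M :: "real \<Rightarrow> real \<Rightarrow> real" where
  "wright_M \<beta> y = (\<Sum>k. (- y) ^ k * rGamma (1 - \<beta> * (real k + 1)) / fact k)"

lemma wright_M_measurable [measurable]: "wright_M \<beta> \<in> borel_measurable borel"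
  unfolding wright_M_def[abs_def] by measurable

lemma Im_complex_of_real_mult: "Im (of_real c * z) = c * Im z"
  by simp

text \<open>The condition on \<open>\<beta> * \<theta>\<close> keeps \<open>Re (s powr \<beta>)\<close> positive along the ray although
  \<open>Re s\<close> tends to minus infinity there.\<close>

locale wright_ray = hankel_ray +
  fixes \<beta> :: real
  assumes \<beta>_pos: "\<beta> > 0" and \<beta>_lt_1: "\<beta> < 1" and \<beta>_\<theta>: "\<beta> * \<theta> < pi / 2"
begin

text \<open>The smallest modulus on the ray's line combined with the largest argument: together they
  bound Re (s^\<beta>) from below. It scales like R^\<beta>.\<close>

definition wright_rate :: real where "wright_rate = (R * sin \<theta>) powr \<beta> * cos (\<beta> * \<theta>)"

lemma wright_rate_pos: "wright_rate > 0"
proof -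
  have "\<beta> * \<theta> > 0" using \<beta>_pos \<theta>_gt pi_gt_zero by (intro mult_pos_pos) linarith+
  then have "cos (\<beta> * \<theta>) > 0" using \<beta>_\<theta> by (intro cos_gt_zero_pi) linarith+
  then show ?thesis using R_pos sin_\<theta>_pos by (simp add: wright_rate_def)
qed

text \<open>Rotated back by \<theta>, the ray lies strictly below the real axis. Hence sin (A -
  \<theta>) < 0 for the argument A, which is impossible for \<theta> \<le> A \<le> \<pi>.\<close>

lemma Im_Ln_ray:
  assumes "r \<ge> 0"
  shows "0 \<le> Im (Ln (ray r))" "Im (Ln (ray r)) \<le> \<theta>"
proof -
  define A where "A = Im (Ln (ray r))"
  show *: "0 \<le> Im (Ln (ray r))"
    using Im_Ln_pos_le[OF ray_nonzero[OF assms]] sin_\<theta>_pos assms by (simp add: Im_ray)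
  have "ray r * cis (- \<theta>) = of_real R * cis (- \<theta>) + of_real r"
    by (simp add: ray_def ring_distribs mult.assoc cis_mult)
  then have 1: "Im (ray r * cis (- \<theta>)) < 0"
    using R_pos sin_\<theta>_pos by simp
  have "ray r = exp (of_real (Re (Ln (ray r))) + \<i> * of_real A)"
    using ray_nonzero[OF assms] exp_Ln[of "ray r"] complex_eq[of "Ln (ray r)"] by (simp add: A_def)
  then have "ray r = of_real (exp (Re (Ln (ray r)))) * cis A"
    by (simp only: exp_add cis_conv_exp exp_of_real)
  then have "ray r * cis (- \<theta>) = of_real (exp (Re (Ln (ray r)))) * cis (A - \<theta>)"
    by (metis cis_mult diff_conv_add_uminus mult.assoc)
  with 1 have "sin (A - \<theta>) < 0"
    by (simp add: mult_less_0_iff)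
  moreover have "A \<le> pi" unfolding A_def by (rule Im_Ln_le_pi[OF ray_nonzero[OF assms]])
  ultimately show "Im (Ln (ray r)) \<le> \<theta>"
    using sin_ge_zero[of "A - \<theta>"] \<theta>_gt pi_gt_zero unfolding A_def by linarith
qed

lemma Re_ray_powr:
  assumes "r \<ge> 0"
  shows "Re (ray r powr of_real \<beta>) \<ge> wright_rate"
proof -
  have "Re (ray r powr of_real \<beta>) = norm (ray r) powr \<beta> * cos (\<beta> * Im (Ln (ray r)))"
    using ray_nonzero[OF assms] by (simp add: powr_def Re_exp)
  also have "\<dots> \<ge> (R * sin \<theta>) powr \<beta> * cos (\<beta> * \<theta>)"
  proof (intro mult_mono)
    show "(R * sin \<theta>) powr \<beta> \<le> norm (ray r) powr \<beta>"
      using R_pos sin_\<theta>_pos \<beta>_pos by (intro powr_mono2 norm_ray_ge) auto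
    show "cos (\<beta> * \<theta>) \<le> cos (\<beta> * Im (Ln (ray r)))"
      using Im_Ln_ray[OF assms] \<beta>_pos \<beta>_\<theta> pi_gt_zero
      by (intro cos_monotone_0_pi_le mult_left_mono mult_nonneg_nonneg) linarith+
    show "cos (\<beta> * \<theta>) \<ge> 0"
      using wright_rate_pos by (simp add: wright_rate_def zero_less_mult_iff)
  qed auto
  finally show ?thesis by (simp add: wright_rate_def)
qed

text \<open>Expanding exp (- y s^\<beta>) inside the contour integral and integrating termwise
  leaves, in the k-th term, Hankel's integral with exponent - (1 - \<beta> (k + 1)), which is a
  reciprocal Gamma value.\<close>

lemma wright_M_sums:
  "(\<lambda>k. (- y) ^ k * rGamma (1 - \<beta> * (real k + 1)) / fact k)
     sums hankel (\<lambda>s. exp s * s powr of_real (\<beta> - 1) * exp (- (of_real y * s powr of_real \<beta>)))"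
proof -
  define v where "v r = cis \<theta> * (exp (ray r) * ray r powr of_real (\<beta> - 1))" for r
  define w where "w r = ray r powr of_real \<beta>" for r
  define f where "f k r = v r * ((- (of_real y * w r)) ^ k / fact k)" for k r
  have f_eq: "f k r = of_real ((- y) ^ k / fact k) * (cis \<theta> * (exp (ray r) * ray r powr of_real (- (1 - \<beta> * (real k + 1)))))"
    if "r \<ge> 0" for k r
  proof -
    have "w r ^ k = ray r powr of_real (real k * \<beta>)"
      using ray_nonzero[OF that] by (simp add: w_def powr_def exp_of_nat_mult[symmetric] mult.assoc)
    then have "ray r powr of_real (\<beta> - 1) * w r ^ k = ray r powr of_real (- (1 - \<beta> * (real k + 1)))"
      by (simp only: powr_add[symmetric] of_real_add[symmetric]) (simp add: algebra_simps)
    moreover have "f k r = of_real ((- y) ^ k / fact k) * (cis \<theta> * (exp (ray r) * (ray r powr of_real (\<beta> - 1) * w r ^ k)))"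
      by (simp add: f_def v_def power_mult_distrib power_minus[of "of_real y * w r"] power_minus[of y] mult_ac)
    ultimately show ?thesis by simp
  qed
  have f_int: "set_integrable lborel {0..} (f k)" for k
  proof -
    have "set_integrable lborel {0..} (\<lambda>r. of_real ((- y) ^ k / fact k) * (cis \<theta> * (exp (ray r) * ray r powr of_real (- (1 - \<beta> * (real k + 1))))))"
      by (intro set_integrable_mult_right ray_powr_integrable)
    then show ?thesis
      by (subst set_integrable_cong[OF refl refl f_eq]) auto
  qed
  have f_val: "Im (LINT r:{0..}|lborel. f k r) / pi = (- y) ^ k * rGamma (1 - \<beta> * (real k + 1)) / fact k" for k
  proof -
    have "(LINT r:{0..}|lborel. f k r) = (LINT r:{0..}|lborel. of_real ((- y) ^ k / fact k) * (cis \<theta> * (exp (ray r) * ray r powr of_real (- (1 - \<beta> * (real k + 1))))))"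
      by (intro set_lebesgue_integral_cong) (auto simp: f_eq)
    also have "\<dots> = of_real ((- y) ^ k / fact k) * (LINT r:{0..}|lborel. cis \<theta> * (exp (ray r) * ray r powr of_real (- (1 - \<beta> * (real k + 1)))))"
      by (rule set_integral_mult_right)
    also have "Im \<dots> / pi = ((- y) ^ k / fact k) * hankel (\<lambda>s. exp s * s powr of_real (- (1 - \<beta> * (real k + 1))))"
      unfolding hankel_def by (simp only: Im_complex_of_real_mult times_divide_eq_right)
    finally show ?thesis unfolding hankel_rGamma by simp
  qed
  obtain C where C: "C > 0"
    "\<And>r. r \<ge> 0 \<Longrightarrow> norm (exp (ray r)) * norm (ray r) powr (\<beta> - 1) * exp (\<bar>y\<bar> * norm (ray r) powr \<beta>)
       \<le> C * exp (- decay * r)"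
    using ray_bound[OF \<beta>_pos \<beta>_lt_1, of "\<beta> - 1" "\<bar>y\<bar>"] by blast
  have "(\<lambda>n. LINT r:{0..}|lborel. (\<Sum>k<n. f k r)) \<longlonglongrightarrow> (LINT r:{0..}|lborel. v r * exp (- (of_real y * w r)))"
    unfolding set_lebesgue_integral_def
  proof (rule integral_dominated_convergence)
    show "integrable lborel (\<lambda>r. indicator {0..} r *\<^sub>R (C * exp (- decay * r)))"
      using set_integrable_mult_right[OF set_integrable_exp_neg[OF decay_pos], of C]
      by (simp add: set_integrable_def)
    show "(\<lambda>r. indicator {0..} r *\<^sub>R (\<Sum>k<n. f k r)) \<in> borel_measurable lborel" for n
      using f_int unfolding set_integrable_def
      by (simp only: scaleR_sum_right) (intro borel_measurable_sum borel_measurable_integrable)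
    have "continuous_on {0..} (\<lambda>r. v r * exp (- (of_real y * w r)))"
      unfolding v_def w_def by (intro continuous_intros continuous_on_ray_powr)
    from borel_measurable_continuous_on_indicator[OF _ this]
    show "(\<lambda>r. indicator {0..} r *\<^sub>R (v r * exp (- (of_real y * w r)))) \<in> borel_measurable lborel"
      by simp
    show "AE r in lborel. (\<lambda>n. indicator {0..} r *\<^sub>R (\<Sum>k<n. f k r)) \<longlonglongrightarrow> indicator {0..} r *\<^sub>R (v r * exp (- (of_real y * w r)))"
    proof (intro AE_I2 tendsto_scaleR tendsto_const)
      fix r
      have "(\<lambda>k. (- (of_real y * w r)) ^ k / fact k) sums exp (- (of_real y * w r))"
        using exp_converges[of "- (of_real y * w r)"] by (simp add: scaleR_conv_of_real divide_inverse mult.commute)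
      from sums_mult[OF this, of "v r"] show "(\<lambda>n. \<Sum>k<n. f k r) \<longlonglongrightarrow> v r * exp (- (of_real y * w r))"
        by (simp add: sums_def f_def)
    qed
    \<comment> \<open>The partial sums are bounded by exp (|y| |s|^\<beta>), uniformly in n; as
      \<beta> < 1, the decay of exp s along the ray is stronger.\<close>
    show "AE r in lborel. norm (indicator {0..} r *\<^sub>R (\<Sum>k<n. f k r)) \<le> indicator {0..} r *\<^sub>R (C * exp (- decay * r))" for n
    proof (intro AE_I2)
      fix r :: real
      have "norm (\<Sum>k<n. f k r) \<le> C * exp (- decay * r)" if r: "r \<ge> 0"
      proof -
        have "norm (\<Sum>k<n. f k r) \<le> (\<Sum>k<n. norm (v r) * ((\<bar>y\<bar> * norm (w r)) ^ k / fact k))"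
          by (rule sum_norm_le) (simp add: f_def norm_mult norm_divide norm_power)
        also have "\<dots> = norm (v r) * (\<Sum>k<n. (\<bar>y\<bar> * norm (w r)) ^ k / fact k)"
          by (simp add: sum_distrib_left)
        also have "\<dots> \<le> norm (v r) * exp (\<bar>y\<bar> * norm (w r))"
          by (intro mult_left_mono sum_power_le_exp) auto
        also have "\<dots> = norm (exp (ray r)) * norm (ray r) powr (\<beta> - 1) * exp (\<bar>y\<bar> * norm (ray r) powr \<beta>)"
          by (simp add: v_def w_def norm_mult norm_powr_real_powr' del: norm_exp_eq_Re of_real_diff)
        also have "\<dots> \<le> C * exp (- decay * r)" by (rule C(2)[OF r])
        finally show ?thesis .
      qed
      then show "norm (indicator {0..} r *\<^sub>R (\<Sum>k<n. f k r)) \<le> indicator {0..} r *\<^sub>R (C * exp (- decay * r))"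
        by (simp add: indicator_def)
    qed
  qed
  also have "(\<lambda>n. LINT r:{0..}|lborel. (\<Sum>k<n. f k r)) = (\<lambda>n. \<Sum>k<n. LINT r:{0..}|lborel. f k r)"
    unfolding set_lebesgue_integral_def scaleR_sum_right
    using f_int by (subst Bochner_Integration.integral_sum) (auto simp: set_integrable_def)
  finally have "(\<lambda>k. LINT r:{0..}|lborel. f k r) sums (LINT r:{0..}|lborel. v r * exp (- (of_real y * w r)))"
    by (simp add: sums_def)
  from sums_divide[OF sums_Im[OF this], of pi] 
  show ?thesis
    unfolding f_val hankel_def v_def w_def by (simp only: mult.assoc)
qed

lemma wright_M_eq_hankel:
  "wright_M \<beta> y = hankel (\<lambda>s. exp s * s powr of_real (\<beta> - 1) * exp (- (of_real y * s powr of_real \<beta>)))"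
  unfolding wright_M_def by (rule sums_unique[symmetric, OF wright_M_sums])


lemma norm_wright_kernel_le:
  assumes "r \<ge> 0" "y \<ge> 0"
  shows "norm (exp (- (of_real y * ray r powr of_real \<beta>))) \<le> exp (- (wright_rate * y))"
  using mult_left_mono[OF Re_ray_powr[OF assms(1)] assms(2)] by (simp add: mult.commute)

lemma wright_M_decay_rate:
  obtains K where "\<And>y. y \<ge> 0 \<Longrightarrow> \<bar>wright_M \<beta> y\<bar> \<le> K * exp (- (wright_rate * y))"
proof -
  obtain C where C: "C > 0"
    "\<And>r. r \<ge> 0 \<Longrightarrow> norm (exp (ray r) * ray r powr of_real (\<beta> - 1)) \<le> C * exp (- decay * r)"
    using ray_bound_powr by blast
  define D where "D = (LINT r:{0..}|lborel. C * exp (- decay * r)) / pi"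
  show thesis
  proof (rule that)
    fix y :: real assume y: "y \<ge> 0"
    have "\<bar>wright_M \<beta> y\<bar> = \<bar>Im (LINT r:{0..}|lborel. cis \<theta> * (exp (ray r) * ray r powr of_real (\<beta> - 1)
        * exp (- (of_real y * ray r powr of_real \<beta>))))\<bar> / pi"
      unfolding wright_M_eq_hankel hankel_def by simp
    also have "\<dots> \<le> norm (LINT r:{0..}|lborel. cis \<theta> * (exp (ray r) * ray r powr of_real (\<beta> - 1)
        * exp (- (of_real y * ray r powr of_real \<beta>)))) / pi"
      by (intro divide_right_mono abs_Im_le_cmod) auto
    also have "\<dots> \<le> (LINT r:{0..}|lborel. C * exp (- decay * r) * exp (- (wright_rate * y))) / pi"
    proof (intro divide_right_mono)
      show "norm (LINT r:{0..}|lborel. cis \<theta> * (exp (ray r) * ray r powr of_real (\<beta> - 1)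
        * exp (- (of_real y * ray r powr of_real \<beta>)))) \<le> (LINT r:{0..}|lborel. C * exp (- decay * r) * exp (- (wright_rate * y)))"
        unfolding set_lebesgue_integral_def
      proof (rule Bochner_Integration.integral_norm_bound_integral)
        have bound: "norm (cis \<theta> * (exp (ray r) * ray r powr of_real (\<beta> - 1) * exp (- (of_real y * ray r powr of_real \<beta>))))
            \<le> C * exp (- decay * r) * exp (- (wright_rate * y))" if "r \<ge> 0" for r
          using mult_mono[OF C(2)[OF that] norm_wright_kernel_le[OF that y]] C(1) by (simp only: norm_mult norm_cis) simp
        show "norm (indicator {0..} r *\<^sub>R (cis \<theta> * (exp (ray r) * ray r powr of_real (\<beta> - 1) * exp (- (of_real y * ray r powr of_real \<beta>)))))
            \<le> indicator {0..} r *\<^sub>R (C * exp (- decay * r) * exp (- (wright_rate * y)))" for r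
        proof (cases "r \<ge> 0")
          case True
          then show ?thesis using bound[OF True] by simp
        qed simp
        show "integrable lborel (\<lambda>r. indicator {0..} r *\<^sub>R (C * exp (- decay * r) * exp (- (wright_rate * y))))"
          using set_integrable_mult_right[OF set_integrable_exp_neg[OF decay_pos], of "C * exp (- (wright_rate * y))"]
          by (simp add: set_integrable_def mult_ac)
        have "set_integrable lborel {0..} (\<lambda>r. cis \<theta> * (exp (ray r) * ray r powr of_real (\<beta> - 1) * exp (- (of_real y * ray r powr of_real \<beta>))))"
          by (rule set_integrable_dominated_exp[OF _ decay_pos, of _ "C * exp (- (wright_rate * y))"])
             (use bound in \<open>auto intro!: continuous_intros continuous_on_ray_powr simp: mult_ac simp del: norm_exp_eq_Re of_real_diff\<close>)
        then show "integrable lborel (\<lambda>r. indicator {0..} r *\<^sub>R (cis \<theta> * (exp (ray r) * ray r powr of_real (\<beta> - 1) * exp (- (of_real y * ray r powr of_real \<beta>)))))"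
          by (simp only: set_integrable_def)
      qed
    qed auto
    also have "\<dots> = D * exp (- (wright_rate * y))"
      unfolding D_def by (simp add: mult_ac)
    finally show "\<bar>wright_M \<beta> y\<bar> \<le> D * exp (- (wright_rate * y))" .
  qed
qed

text \<open>After exchanging the integrals, the one over y is the Laplace integral m! /
  (s^\<beta>)^(m+1). Together with s^(\<beta> - 1) it leaves the single power s^(- (1 + \<beta> m)),
  to which Hankel's formula applies again.\<close>

lemma wright_M_moment:
  "(LINT y:{0..}|lborel. y ^ m * wright_M \<beta> y) = fact m * rGamma (1 + \<beta> * real m)"
proof -
  define v where "v r = cis \<theta> * (exp (ray r) * ray r powr of_real (\<beta> - 1))" for r
  define w where "w r = ray r powr of_real \<beta>" for r
  \<comment> \<open>Cut off at r < 0 because \<open>w\<close> is only known to be continuous on the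
    half-line; joint measurability of \<open>g\<close> is read off from \<open>u\<close>.\<close>
  define u where "u r = indicator {0..} r *\<^sub>R w r" for r
  define g where "g y r = (indicator {0..} y * indicator {0..} r) *\<^sub>R (v r * (of_real y ^ m * exp (- (of_real y * w r))))" for y r :: real
  have v_int: "set_integrable lborel {0..} v"
    unfolding v_def by (rule ray_powr_integrable)
  have w_Re: "Re (w r) \<ge> wright_rate" if "r \<ge> 0" for r
    unfolding w_def by (rule Re_ray_powr[OF that])
  have [measurable]: "(\<lambda>r. indicator {0..} r *\<^sub>R v r) \<in> borel_measurable borel"
    using v_int unfolding set_integrable_def by (auto dest: borel_measurable_integrable)
  have [measurable]: "u \<in> borel_measurable borel"
    unfolding u_def w_def by (intro borel_measurable_continuous_on_indicator continuous_on_ray_powr) auto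
  have g_eq: "g y r = indicator {0..} y *\<^sub>R ((indicator {0..} r *\<^sub>R v r) * (of_real y ^ m * exp (- (of_real y * u r))))" for y r
    by (auto simp: g_def u_def indicator_def)
  have g_meas: "case_prod g \<in> borel_measurable (lborel \<Otimes>\<^sub>M lborel)"
    unfolding g_eq[abs_def] by measurable
  \<comment> \<open>The lower bound \<open>wright_rate\<close> for Re w does not depend on r, so the
    majorant is a product of a function of y and a function of r.\<close>
  define B where "B y = indicator {0..} y *\<^sub>R (y ^ m * exp (- (wright_rate * y)))" for y :: real
  have B_int: "integrable lborel B"
  proof -
    have "integrable lborel (\<lambda>y. indicator {0..} y *\<^sub>R (of_real y ^ m * exp (- (of_real y * complex_of_real wright_rate))))"
      using laplace_power_integrable[of "of_real wright_rate" m] wright_rate_pos by (simp add: set_integrable_def)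
    from integrable_norm[OF this] show ?thesis
      by (rule Bochner_Integration.integrable_cong[THEN iffD1, rotated 2])
         (auto simp: B_def norm_mult norm_power indicator_def mult.commute)
  qed
  have g_bound: "norm (g y r) \<le> B y * norm (indicator {0..} r *\<^sub>R v r)" for y r
  proof (cases "y \<ge> 0 \<and> r \<ge> 0")
    case True
    then have "y ^ m * exp (- (y * Re (w r))) \<le> y ^ m * exp (- (wright_rate * y))"
      using mult_left_mono[OF w_Re[of r], of y] by (intro mult_left_mono) (auto simp: mult.commute)
    from mult_left_mono[OF this norm_ge_zero, of "v r"] True show ?thesis
      by (simp add: g_def B_def norm_mult norm_power mult_ac)
  qed (auto simp: g_def B_def indicator_def)
  have int_product: "integrable (lborel \<Otimes>\<^sub>M lborel) (case_prod g)"
  proof (rule Bochner_Integration.integrable_bound[OF _ g_meas])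
    show "integrable (lborel \<Otimes>\<^sub>M lborel) (\<lambda>(y, r). B y * norm (indicator {0..} r *\<^sub>R v r))"
      using v_int unfolding set_integrable_def
      by (intro integrable_product sigma_finite_lborel B_int integrable_norm)
    show "AE x in lborel \<Otimes>\<^sub>M lborel. norm (case_prod g x)
        \<le> norm (case x of (y, r) \<Rightarrow> B y * norm (indicator {0..} r *\<^sub>R v r))"
    proof (rule AE_I2)
      fix x :: "real \<times> real"
      obtain y r where x: "x = (y, r)" by (cases x)
      show "norm (case_prod g x) \<le> norm (case x of (y, r) \<Rightarrow> B y * norm (indicator {0..} r *\<^sub>R v r))"
        unfolding x case_prod_conv real_norm_def by (rule order_trans[OF g_bound abs_ge_self])
    qed
  qed
  have "(LINT y:{0..}|lborel. y ^ m * wright_M \<beta> y) = (\<integral>y. Im (\<integral>r. g y r \<partial>lborel) / pi \<partial>lborel)"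
    unfolding set_lebesgue_integral_def
  proof (rule Bochner_Integration.integral_cong[OF refl])
    fix y
    have "indicator {0..} y *\<^sub>R (y ^ m * wright_M \<beta> y) = Im (of_real (indicator {0..} y * y ^ m) *
        (LINT r:{0..}|lborel. v r * exp (- (of_real y * w r)))) / pi"
      unfolding wright_M_eq_hankel hankel_def v_def w_def Im_complex_of_real_mult by (simp only: mult.assoc real_scaleR_def times_divide_eq_right)
    also have "of_real (indicator {0..} y * y ^ m) * (LINT r:{0..}|lborel. v r * exp (- (of_real y * w r))) = (\<integral>r. g y r \<partial>lborel)"
      unfolding set_lebesgue_integral_def integral_mult_right_zero[symmetric]
      by (rule Bochner_Integration.integral_cong) (auto simp: g_def indicator_def)
    finally show "indicator {0..} y *\<^sub>R (y ^ m * wright_M \<beta> y) = Im (\<integral>r. g y r \<partial>lborel) / pi" .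
  qed
  also have "\<dots> = Im (\<integral>y. (\<integral>r. g y r \<partial>lborel) \<partial>lborel) / pi"
    using lborel_pair.integrable_fst'[OF int_product] by (simp add: integral_Im)
  also have "(\<integral>y. (\<integral>r. g y r \<partial>lborel) \<partial>lborel) = (\<integral>r. (\<integral>y. g y r \<partial>lborel) \<partial>lborel)"
    using lborel_pair.Fubini_integral[OF int_product] by simp
  also have "\<dots> = (LINT r:{0..}|lborel. of_real (fact m) * (cis \<theta> * (exp (ray r) * ray r powr of_real (- (1 + \<beta> * real m)))))"
    unfolding set_lebesgue_integral_def
  proof (rule Bochner_Integration.integral_cong[OF refl])
    fix r :: real
    show "(\<integral>y. g y r \<partial>lborel) = indicator {0..} r *\<^sub>R (of_real (fact m) * (cis \<theta> * (exp (ray r) * ray r powr of_real (- (1 + \<beta> * real m)))))"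
    proof (cases "r \<ge> 0")
      case True
      have "(\<integral>y. g y r \<partial>lborel) = v r * (LINT y:{0..}|lborel. of_real y ^ m * exp (- (of_real y * w r)))"
        unfolding set_lebesgue_integral_def integral_mult_right_zero[symmetric]
        by (rule Bochner_Integration.integral_cong) (use True in \<open>auto simp: g_def indicator_def\<close>)
      also have "\<dots> = v r * (fact m / w r ^ Suc m)"
        using w_Re[OF True] wright_rate_pos by (subst laplace_power) auto
      also have "\<dots> = of_real (fact m) * (cis \<theta> * (exp (ray r) * (ray r powr of_real (\<beta> - 1) / w r ^ Suc m)))"
        by (simp add: v_def)
      also have "w r ^ Suc m = ray r powr of_real (real (Suc m) * \<beta>)"
        using ray_nonzero[OF True] by (simp only: w_def powr_def if_False exp_of_nat_mult[symmetric] of_real_mult of_real_of_nat_eq mult.assoc)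
      also have "ray r powr of_real (\<beta> - 1) / ray r powr of_real (real (Suc m) * \<beta>) = ray r powr of_real (- (1 + \<beta> * real m))"
        by (simp only: powr_diff[symmetric] of_real_diff[symmetric]) (simp add: algebra_simps)
      finally show ?thesis using True by simp
    qed (simp add: g_def)
  qed
  also have "\<dots> = of_real (fact m) * (LINT r:{0..}|lborel. cis \<theta> * (exp (ray r) * ray r powr of_real (- (1 + \<beta> * real m))))"
    by (rule set_integral_mult_right)
  also have "Im \<dots> / pi = fact m * hankel (\<lambda>s. exp s * s powr of_real (- (1 + \<beta> * real m)))"
    unfolding hankel_def by (simp only: Im_complex_of_real_mult times_divide_eq_right)
  also have "\<dots> = fact m * rGamma (1 + \<beta> * real m)"
    by (simp only: hankel_rGamma)
  finally show ?thesis .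
qed

end

section \<open>Freedom in the choice of the contour\<close>

lemma wright_ray_exists:
  fixes \<beta> c :: real
  assumes "0 < \<beta>" "\<beta> < 1"
  obtains R \<theta> where "wright_ray R \<theta> \<beta>" "c \<le> (R * sin \<theta>) powr \<beta> * cos (\<beta> * \<theta>)"
proof -
  \<comment> \<open>An explicit angle in the admissible range: the three conditions on it all reduce
    to 0 < \<beta> < 1.\<close>
  define \<theta> where "\<theta> = pi / (1 + \<beta>)"
  have \<theta>: "pi / 2 < \<theta>" "\<theta> < pi" "\<beta> * \<theta> < pi / 2"
    using assms pi_gt_zero by (auto simp: \<theta>_def field_simps)
  have s: "sin \<theta> > 0" using \<theta> by (intro sin_gt_zero) linarith+
  have "\<beta> * \<theta> > 0" using assms \<theta> pi_gt_zero by (intro mult_pos_pos) linarith+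
  then have k: "cos (\<beta> * \<theta>) > 0" using \<theta> by (intro cos_gt_zero_pi) linarith+
  \<comment> \<open>Chosen, together with R, so that the decay rate becomes exactly |c| + 1.\<close>
  define x where "x = (\<bar>c\<bar> + 1) / cos (\<beta> * \<theta>)"
  have x: "x > 0" using k by (simp add: x_def)
  define R where "R = x powr (1 / \<beta>) / sin \<theta>"
  have "(R * sin \<theta>) powr \<beta> = x"
    using s x assms by (simp add: R_def powr_powr)
  then have "c \<le> (R * sin \<theta>) powr \<beta> * cos (\<beta> * \<theta>)"
    using k by (simp add: x_def)
  moreover have "wright_ray R \<theta> \<beta>"
    by unfold_locales (use assms \<theta> s x in \<open>auto simp: R_def\<close>)
  ultimately show thesis by (rule that[rotated])
qed

text \<open>The decay rate grows without bound with the vertex \<open>R\<close> of the contour.\<close>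

lemma wright_M_decay:
  fixes \<beta> c :: real
  assumes "0 < \<beta>" "\<beta> < 1"
  obtains K where "K \<ge> 0" "\<And>y. y \<ge> 0 \<Longrightarrow> \<bar>wright_M \<beta> y\<bar> \<le> K * exp (- (c * y))"
proof -
  obtain R \<theta> where R: "wright_ray R \<theta> \<beta>" "c \<le> (R * sin \<theta>) powr \<beta> * cos (\<beta> * \<theta>)"
    using wright_ray_exists[OF assms] by blast
  interpret wright_ray R \<theta> \<beta> by (rule R)
  obtain K where K: "\<And>y. y \<ge> 0 \<Longrightarrow> \<bar>wright_M \<beta> y\<bar> \<le> K * exp (- (wright_rate * y))"
    using wright_M_decay_rate by blast
  have "K \<ge> 0" using order_trans[OF abs_ge_zero K[of 0]] by simp
  show thesis
  proof (rule that[OF \<open>K \<ge> 0\<close>])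
    fix y :: real assume y: "y \<ge> 0"
    have "c * y \<le> wright_rate * y"
      using R(2) y unfolding wright_rate_def by (rule mult_right_mono)
    then have "K * exp (- (wright_rate * y)) \<le> K * exp (- (c * y))"
      using \<open>K \<ge> 0\<close> by (intro mult_left_mono) auto
    with K[OF y] show "\<bar>wright_M \<beta> y\<bar> \<le> K * exp (- (c * y))" by linarith
  qed
qed

lemma wright_M_moments:
  assumes "0 < \<beta>" "\<beta> < 1"
  shows "(LINT y:{0..}|lborel. y ^ m * wright_M \<beta> y) = fact m * rGamma (1 + \<beta> * real m)"
proof -
  obtain R \<theta> where "wright_ray R \<theta> \<beta>" using wright_ray_exists[OF assms] by blast
  then interpret wright_ray R \<theta> \<beta> .
  show ?thesis by (rule wright_M_moment)
qed

subsection \<open>Integrals determined by moments\<close>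

lemma moments_integrable:
  fixes W \<psi> :: "'a \<Rightarrow> real"
  assumes [measurable]: "W \<in> borel_measurable M" "\<psi> \<in> borel_measurable M"
    and nonneg: "\<And>x. x \<in> space M \<Longrightarrow> \<psi> x \<ge> 0"
    and int: "\<And>c. integrable M (\<lambda>x. W x * exp (c * \<psi> x))"
  shows "integrable M (\<lambda>x. W x * \<psi> x ^ m)"
proof (rule Bochner_Integration.integrable_bound)
  show "integrable M (\<lambda>x. fact m * (W x * exp (1 * \<psi> x)))"
    by (intro integrable_mult_right int)
  show "AE x in M. norm (W x * \<psi> x ^ m) \<le> norm (fact m * (W x * exp (1 * \<psi> x)))"
  proof (intro AE_I2)
    fix x assume x: "x \<in> space M"
    have "\<psi> x ^ m \<le> fact m * exp (\<psi> x)"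
      using power_le_exp[of 1 "\<psi> x" m] nonneg[OF x] by simp
    from mult_left_mono[OF this, of "\<bar>W x\<bar>"]
    show "norm (W x * \<psi> x ^ m) \<le> norm (fact m * (W x * exp (1 * \<psi> x)))"
      using nonneg[OF x] by (simp add: abs_mult mult_ac)
  qed
qed measurable

text \<open>Dominated convergence, with majorant |W| exp (|s| \<psi>). The lemma turns equality of
  all moments into equality of all integrals against exponentials.\<close>

lemma moments_sums_exp:
  fixes W \<psi> :: "'a \<Rightarrow> real"
  assumes [measurable]: "W \<in> borel_measurable M" "\<psi> \<in> borel_measurable M"
    and nonneg: "\<And>x. x \<in> space M \<Longrightarrow> \<psi> x \<ge> 0"
    and int: "\<And>c. integrable M (\<lambda>x. W x * exp (c * \<psi> x))"
  shows "(\<lambda>m. s ^ m / fact m * (\<integral>x. W x * \<psi> x ^ m \<partial>M)) sums (\<integral>x. W x * exp (s * \<psi> x) \<partial>M)"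
proof -
  have "(\<lambda>n. \<integral>x. (\<Sum>m<n. s ^ m / fact m * (W x * \<psi> x ^ m)) \<partial>M) \<longlonglongrightarrow> (\<integral>x. W x * exp (s * \<psi> x) \<partial>M)"
  proof (rule integral_dominated_convergence)
    show "integrable M (\<lambda>x. \<bar>W x * exp (\<bar>s\<bar> * \<psi> x)\<bar>)"
      by (intro integrable_abs int)
    show "AE x in M. (\<lambda>n. \<Sum>m<n. s ^ m / fact m * (W x * \<psi> x ^ m)) \<longlonglongrightarrow> W x * exp (s * \<psi> x)"
    proof (intro AE_I2)
      fix x
      have "(\<lambda>m. (s * \<psi> x) ^ m / fact m) sums exp (s * \<psi> x)"
        using exp_converges[of "s * \<psi> x"] by (simp add: divide_inverse mult.commute)
      from sums_mult[OF this, of "W x"]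
      show "(\<lambda>n. \<Sum>m<n. s ^ m / fact m * (W x * \<psi> x ^ m)) \<longlonglongrightarrow> W x * exp (s * \<psi> x)"
        by (simp add: sums_def power_mult_distrib mult_ac)
    qed
    show "AE x in M. norm (\<Sum>m<n. s ^ m / fact m * (W x * \<psi> x ^ m)) \<le> \<bar>W x * exp (\<bar>s\<bar> * \<psi> x)\<bar>" for n
    proof (intro AE_I2)
      fix x assume x: "x \<in> space M"
      have "norm (\<Sum>m<n. s ^ m / fact m * (W x * \<psi> x ^ m)) \<le> (\<Sum>m<n. \<bar>W x\<bar> * ((\<bar>s\<bar> * \<psi> x) ^ m / fact m))"
        using nonneg[OF x] by (intro sum_norm_le) (simp add: abs_mult power_abs power_mult_distrib mult_ac)
      also have "\<dots> = \<bar>W x\<bar> * (\<Sum>m<n. (\<bar>s\<bar> * \<psi> x) ^ m / fact m)"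
        by (simp add: sum_distrib_left)
      also have "\<dots> \<le> \<bar>W x\<bar> * exp (\<bar>s\<bar> * \<psi> x)"
        using nonneg[OF x] by (intro mult_left_mono sum_power_le_exp) auto
      finally show "norm (\<Sum>m<n. s ^ m / fact m * (W x * \<psi> x ^ m)) \<le> \<bar>W x * exp (\<bar>s\<bar> * \<psi> x)\<bar>"
        by (simp add: abs_mult)
    qed
  qed measurable
  also have "(\<lambda>n. \<integral>x. (\<Sum>m<n. s ^ m / fact m * (W x * \<psi> x ^ m)) \<partial>M)
      = (\<lambda>n. \<Sum>m<n. s ^ m / fact m * (\<integral>x. W x * \<psi> x ^ m \<partial>M))"
    by (subst Bochner_Integration.integral_sum)
       (auto intro!: moments_integrable assms)
  finally show ?thesis by (simp add: sums_def)
qed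

text \<open>Extending k to the left of 0 by the constant k 0 makes statements about the whole line,
  such as Borel measurability, available.\<close>

lemma continuous_max_0:
  fixes k :: "real \<Rightarrow> real"
  assumes "continuous_on {0..} k"
  shows "continuous_on A (\<lambda>x. k (max 0 x))"
  by (rule continuous_on_compose2[OF assms]) (auto intro!: continuous_intros)

text \<open>Weierstrass approximation in the variable \<open>exp (- x)\<close>; the extra factor \<open>exp (- x)\<close> in the
  weight makes the transformed function vanish at \<open>0\<close>.\<close>

lemma exp_weighted_approximation:
  fixes k :: "real \<Rightarrow> real"
  assumes k: "continuous_on {0..} k" and bound: "\<And>x. x \<ge> 0 \<Longrightarrow> \<bar>k x\<bar> \<le> S * exp (c * x)" and "\<epsilon> > 0"
  obtains a n where "\<And>x. x \<ge> 0 \<Longrightarrow> \<bar>k x - (\<Sum>i\<le>n. a i * exp ((c + 1 - real i) * x))\<bar> \<le> \<epsilon> * exp ((c + 1) * x)"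
proof -
  \<comment> \<open>The \<open>max 0\<close> freezes k beyond x = 1, so that continuity at x = 1 can
    be obtained from a two-sided statement.\<close>
  define q where "q x = (if x \<le> 0 then 0 else k (max 0 (- ln x)) * x powr (c + 1))" for x
  have "continuous (at x within {0..1}) q" if x: "x \<in> {0..1}" for x
  proof (cases "x = 0")
    case True
    have "((\<lambda>x. S * x) \<longlongrightarrow> S * 0) (at 0 within {0..1})" by (intro tendsto_intros)
    moreover have "norm (q x) \<le> S * x" if "x \<in> {0..1}" for x
    proof (cases "x = 0")
      case False
      then have "max 0 (- ln x) = - ln x" using that by simp
      with False that have "norm (q x) = \<bar>k (- ln x)\<bar> * x powr (c + 1)"
        by (simp add: q_def abs_mult)
      also have "\<dots> \<le> S * exp (c * (- ln x)) * x powr (c + 1)"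
        using False that by (intro mult_right_mono bound) auto
      also have "\<dots> = S * (exp (- (c * ln x)) * exp (c * ln x + ln x))"
        using False by (simp add: powr_def algebra_simps)
      also have "exp (- (c * ln x)) * exp (c * ln x + ln x) = x"
        using False that by (simp add: mult_exp_exp)
      finally show ?thesis by simp
    qed (simp add: q_def)
    ultimately have "(q \<longlongrightarrow> 0) (at 0 within {0..1})"
      by (intro Lim_null_comparison[of q "\<lambda>x. S * x"]) (auto simp: eventually_at_filter)
    then show ?thesis using True by (simp add: continuous_within q_def)
  next
    case False
    have *: "isCont (\<lambda>y. k (max 0 y)) (- ln x)"
      using continuous_max_0[OF k, of UNIV] by (simp add: continuous_on_eq_continuous_at)
    have **: "isCont (\<lambda>x. - ln x) x" "isCont (\<lambda>x. x powr (c + 1)) x"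
      using x False unfolding isCont_def by (auto intro!: tendsto_minus tendsto_ln tendsto_powr)
    from isCont_o2[OF **(1) *] **(2) have "isCont (\<lambda>x. k (max 0 (- ln x)) * x powr (c + 1)) x"
      by (rule isCont_mult)
    then have "continuous (at x within {0..1}) (\<lambda>x. k (max 0 (- ln x)) * x powr (c + 1))"
      by (rule continuous_at_imp_continuous_at_within)
    then show ?thesis
      by (rule continuous_transform_within[where \<delta> = x]) (use x False in \<open>auto simp: q_def dist_real_def\<close>)
  qed
  then have "continuous_on {0..1} q" by (simp add: continuous_on_eq_continuous_within)
  then obtain p where p: "real_polynomial_function p" "\<And>x. x \<in> {0..1} \<Longrightarrow> \<bar>q x - p x\<bar> < \<epsilon>"
    using Stone_Weierstrass_real_polynomial_function[of "{0..1::real}" q \<epsilon>] \<open>\<epsilon> > 0\<close> by auto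
  then obtain a n where an: "p = (\<lambda>x. \<Sum>i\<le>n. a i * x ^ i)"
    by (auto simp: real_polynomial_function_iff_sum)
  show thesis
  proof (rule that)
    fix x :: real assume x: "x \<ge> 0"
    have "exp ((c + 1) * x) * q (exp (- x)) = k x"
      using x by (simp add: q_def powr_def mult_exp_exp)
    moreover have "exp ((c + 1) * x) * p (exp (- x)) = (\<Sum>i\<le>n. a i * exp ((c + 1 - real i) * x))"
      unfolding an sum_distrib_left
    proof (intro sum.cong refl)
      fix i
      have "exp ((c + 1) * x) * exp (- x) ^ i = exp ((c + 1 - real i) * x)"
        unfolding exp_of_nat_mult[symmetric] mult_exp_exp
        by (rule arg_cong[of _ _ exp]) (simp add: algebra_simps)
      then show "exp ((c + 1) * x) * (a i * exp (- x) ^ i) = a i * exp ((c + 1 - real i) * x)"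
        by simp
    qed
    ultimately have "k x - (\<Sum>i\<le>n. a i * exp ((c + 1 - real i) * x)) = exp ((c + 1) * x) * (q (exp (- x)) - p (exp (- x)))"
      by (simp add: right_diff_distrib)
    then have "\<bar>k x - (\<Sum>i\<le>n. a i * exp ((c + 1 - real i) * x))\<bar> = exp ((c + 1) * x) * \<bar>q (exp (- x)) - p (exp (- x))\<bar>"
      by (simp add: abs_mult)
    also have "\<dots> \<le> exp ((c + 1) * x) * \<epsilon>"
      using p(2)[of "exp (- x)"] x by (intro mult_left_mono) auto
    finally show "\<bar>k x - (\<Sum>i\<le>n. a i * exp ((c + 1 - real i) * x))\<bar> \<le> \<epsilon> * exp ((c + 1) * x)"
      by (simp add: mult.commute)
  qed
qed

lemma exp_bounded_integrable:
  fixes W \<psi> :: "'a \<Rightarrow> real" and k :: "real \<Rightarrow> real"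
  assumes [measurable]: "W \<in> borel_measurable M" "\<psi> \<in> borel_measurable M"
    and nonneg: "\<And>x. x \<in> space M \<Longrightarrow> \<psi> x \<ge> 0"
    and int: "\<And>c. integrable M (\<lambda>x. W x * exp (c * \<psi> x))"
    and k: "continuous_on {0..} k" and bound: "\<And>x. x \<ge> 0 \<Longrightarrow> \<bar>k x\<bar> \<le> S * exp (c * x)"
  shows "integrable M (\<lambda>x. W x * k (\<psi> x))"
proof (rule Bochner_Integration.integrable_bound)
  show "integrable M (\<lambda>x. S * (W x * exp (c * \<psi> x)))"
    by (intro integrable_mult_right int)
  have [measurable]: "(\<lambda>y. k (max 0 y)) \<in> borel_measurable borel"
    by (intro borel_measurable_continuous_onI continuous_max_0 k)
  have "(\<lambda>x. W x * k (max 0 (\<psi> x))) \<in> borel_measurable M" by measurable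
  then show "(\<lambda>x. W x * k (\<psi> x)) \<in> borel_measurable M"
    by (rule measurable_cong[THEN iffD1, rotated]) (simp add: nonneg max_def)
  show "AE x in M. norm (W x * k (\<psi> x)) \<le> norm (S * (W x * exp (c * \<psi> x)))"
  proof (intro AE_I2)
    fix x assume "x \<in> space M"
    then have "\<bar>k (\<psi> x)\<bar> \<le> \<bar>S * exp (c * \<psi> x)\<bar>"
      using bound[OF nonneg] by (meson abs_ge_self order_trans)
    from mult_left_mono[OF this, of "\<bar>W x\<bar>"]
    show "norm (W x * k (\<psi> x)) \<le> norm (S * (W x * exp (c * \<psi> x)))"
      by (simp add: abs_mult mult_ac)
  qed
qed

lemma exp_approximation_integral:
  fixes W \<psi> :: "'a \<Rightarrow> real" and k :: "real \<Rightarrow> real"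
  assumes meas: "W \<in> borel_measurable M" "\<psi> \<in> borel_measurable M"
    and nonneg: "\<And>x. x \<in> space M \<Longrightarrow> \<psi> x \<ge> 0"
    and int: "\<And>c. integrable M (\<lambda>x. W x * exp (c * \<psi> x))"
    and k: "continuous_on {0..} k" and bound: "\<And>x. x \<ge> 0 \<Longrightarrow> \<bar>k x\<bar> \<le> S * exp (c * x)"
    and a: "\<And>x. x \<ge> 0 \<Longrightarrow> \<bar>k x - (\<Sum>i\<le>n. a i * exp (b i * x))\<bar> \<le> \<epsilon> * exp (C * x)"
  shows "\<bar>(\<integral>x. W x * k (\<psi> x) \<partial>M) - (\<Sum>i\<le>n. a i * (\<integral>x. W x * exp (b i * \<psi> x) \<partial>M))\<bar>
      \<le> \<epsilon> * (\<integral>x. \<bar>W x * exp (C * \<psi> x)\<bar> \<partial>M)"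
proof -
  define g where "g x = W x * k (\<psi> x) - (\<Sum>i\<le>n. a i * (W x * exp (b i * \<psi> x)))" for x
  have int_k: "integrable M (\<lambda>x. W x * k (\<psi> x))"
    using exp_bounded_integrable[OF meas nonneg int k bound] .
  have int_sum: "integrable M (\<lambda>x. \<Sum>i\<le>n. a i * (W x * exp (b i * \<psi> x)))"
    by (intro Bochner_Integration.integrable_sum integrable_mult_right int)
  have int_g: "integrable M g"
    unfolding g_def[abs_def] by (intro Bochner_Integration.integrable_diff int_k int_sum)
  have "(\<Sum>i\<le>n. a i * (\<integral>x. W x * exp (b i * \<psi> x) \<partial>M)) = (\<integral>x. (\<Sum>i\<le>n. a i * (W x * exp (b i * \<psi> x))) \<partial>M)"
    using int by (subst Bochner_Integration.integral_sum) auto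
  then have "(\<integral>x. W x * k (\<psi> x) \<partial>M) - (\<Sum>i\<le>n. a i * (\<integral>x. W x * exp (b i * \<psi> x) \<partial>M)) = (\<integral>x. g x \<partial>M)"
    using int_k int_sum by (simp add: g_def)
  also have "\<bar>\<dots>\<bar> \<le> (\<integral>x. \<bar>g x\<bar> \<partial>M)"
    using integral_norm_bound[of M g] by simp
  also have "\<dots> \<le> (\<integral>x. \<epsilon> * \<bar>W x * exp (C * \<psi> x)\<bar> \<partial>M)"
  proof (rule integral_mono)
    show "integrable M (\<lambda>x. \<bar>g x\<bar>)" by (intro integrable_abs int_g)
    show "integrable M (\<lambda>x. \<epsilon> * \<bar>W x * exp (C * \<psi> x)\<bar>)"
      by (intro integrable_mult_right integrable_abs int)
    fix x assume "x \<in> space M"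
    from a[OF nonneg[OF this]]
    have "\<bar>W x\<bar> * \<bar>k (\<psi> x) - (\<Sum>i\<le>n. a i * exp (b i * \<psi> x))\<bar> \<le> \<bar>W x\<bar> * (\<epsilon> * exp (C * \<psi> x))"
      by (rule mult_left_mono) simp
    moreover have "g x = W x * (k (\<psi> x) - (\<Sum>i\<le>n. a i * exp (b i * \<psi> x)))"
      by (simp add: g_def right_diff_distrib sum_distrib_left mult_ac)
    ultimately show "\<bar>g x\<bar> \<le> \<epsilon> * \<bar>W x * exp (C * \<psi> x)\<bar>"
      by (simp add: abs_mult mult_ac)
  qed
  finally show ?thesis by simp
qed

text \<open>Finite sums of exponentials have equal integrals by the series above. A general k is
  approximated by such sums with an error relative to exp ((c + 1) x), a function integrable against
  both weights.\<close>

lemma moments_determine_integral: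
  fixes W1 \<psi>1 :: "'a \<Rightarrow> real" and W2 \<psi>2 :: "'b \<Rightarrow> real" and k :: "real \<Rightarrow> real"
  assumes meas1: "W1 \<in> borel_measurable M1" "\<psi>1 \<in> borel_measurable M1"
    and nonneg1: "\<And>x. x \<in> space M1 \<Longrightarrow> \<psi>1 x \<ge> 0"
    and int1: "\<And>c. integrable M1 (\<lambda>x. W1 x * exp (c * \<psi>1 x))"
    and meas2: "W2 \<in> borel_measurable M2" "\<psi>2 \<in> borel_measurable M2"
    and nonneg2: "\<And>x. x \<in> space M2 \<Longrightarrow> \<psi>2 x \<ge> 0"
    and int2: "\<And>c. integrable M2 (\<lambda>x. W2 x * exp (c * \<psi>2 x))"
    and moments: "\<And>m. (\<integral>x. W1 x * \<psi>1 x ^ m \<partial>M1) = (\<integral>x. W2 x * \<psi>2 x ^ m \<partial>M2)"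
    and k: "continuous_on {0..} k" and bound: "\<And>x. x \<ge> 0 \<Longrightarrow> \<bar>k x\<bar> \<le> S * exp (c * x)"
  shows "(\<integral>x. W1 x * k (\<psi>1 x) \<partial>M1) = (\<integral>x. W2 x * k (\<psi>2 x) \<partial>M2)"
proof -
  have exp_eq: "(\<integral>x. W1 x * exp (s * \<psi>1 x) \<partial>M1) = (\<integral>x. W2 x * exp (s * \<psi>2 x) \<partial>M2)" for s
    using sums_unique2[OF moments_sums_exp[OF meas1 nonneg1 int1, of s, unfolded moments]
        moments_sums_exp[OF meas2 nonneg2 int2, of s]] .
  define B1 where "B1 = (\<integral>x. \<bar>W1 x * exp ((c + 1) * \<psi>1 x)\<bar> \<partial>M1)"
  define B2 where "B2 = (\<integral>x. \<bar>W2 x * exp ((c + 1) * \<psi>2 x)\<bar> \<partial>M2)"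
  have B: "B1 \<ge> 0" "B2 \<ge> 0" by (simp_all add: B1_def B2_def)
  define d where "d = \<bar>(\<integral>x. W1 x * k (\<psi>1 x) \<partial>M1) - (\<integral>x. W2 x * k (\<psi>2 x) \<partial>M2)\<bar>"
  have d_le: "d \<le> \<epsilon> * (B1 + B2)" if \<epsilon>_pos: "\<epsilon> > 0" for \<epsilon>
  proof -
    obtain a n where a: "\<And>x. x \<ge> 0 \<Longrightarrow> \<bar>k x - (\<Sum>i\<le>n. a i * exp ((c + 1 - real i) * x))\<bar> \<le> \<epsilon> * exp ((c + 1) * x)"
      using exp_weighted_approximation[OF k bound \<epsilon>_pos] by blast
    from exp_approximation_integral[OF meas1 nonneg1 int1 k bound a]
      exp_approximation_integral[OF meas2 nonneg2 int2 k bound a] show ?thesis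
      unfolding d_def B1_def B2_def exp_eq distrib_left by linarith
  qed
  have "d = 0"
  proof (rule ccontr)
    assume "d \<noteq> 0"
    then have d: "d > 0" by (simp add: d_def)
    \<comment> \<open>This \<epsilon> makes the bound at most half of d; the summand 1 keeps the
      denominator positive even if both constants vanish.\<close>
    have "d \<le> d / (2 * (B1 + B2 + 1)) * (B1 + B2)"
      using d B by (intro d_le divide_pos_pos) auto
    also have "\<dots> < d"
    proof -
      have "(B1 + B2) / (2 * (B1 + B2 + 1)) < 1" using B by (simp add: divide_less_eq)
      from mult_strict_left_mono[OF this d] show ?thesis by simp
    qed
    finally show False by simp
  qed
  then show ?thesis by (simp add: d_def)
qed

subsection \<open>The Wright transform and the Caputo derivative\<close>

text \<open>\<open>exp_order\<close> speaks of large arguments only; continuity on the remaining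
  compact interval supplies a bound on the whole half-line.\<close>

lemma exp_order_imp_bound:
  assumes f: "continuous_on {0..} f" and "exp_order f"
  obtains S c where "S \<ge> 0" "c \<ge> 0" "\<And>x. x \<ge> 0 \<Longrightarrow> \<bar>f x\<bar> \<le> S * exp (c * x)"
proof -
  obtain M c T where M: "\<And>t. t \<ge> T \<Longrightarrow> \<bar>f t\<bar> \<le> M * exp (c * t)"
    using assms(2) by (auto simp: exp_order_def)
  have "bounded (f ` {0..T})"
    by (intro compact_imp_bounded compact_continuous_image continuous_on_subset[OF f]) auto
  then obtain D where D: "\<And>x. x \<in> {0..T} \<Longrightarrow> \<bar>f x\<bar> \<le> D"
    unfolding bounded_iff by (metis image_eqI real_norm_def)
  show thesis
  proof (rule that[of "\<bar>M\<bar> + \<bar>D\<bar>" "\<bar>c\<bar>"])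
    fix x :: real assume x: "x \<ge> 0"
    show "\<bar>f x\<bar> \<le> (\<bar>M\<bar> + \<bar>D\<bar>) * exp (\<bar>c\<bar> * x)"
    proof (cases "x \<ge> T")
      case True
      have "\<bar>f x\<bar> \<le> M * exp (c * x)" by (rule M[OF True])
      also have "\<dots> \<le> (\<bar>M\<bar> + \<bar>D\<bar>) * exp (\<bar>c\<bar> * x)"
        using x by (intro mult_mono) (auto intro!: mult_right_mono)
      finally show ?thesis .
    next
      case False
      then have "\<bar>f x\<bar> \<le> D" using D x by auto
      also have "D \<le> (\<bar>M\<bar> + \<bar>D\<bar>) * 1" by simp
      also have "\<dots> \<le> (\<bar>M\<bar> + \<bar>D\<bar>) * exp (\<bar>c\<bar> * x)"
        using x by (intro mult_left_mono) auto
      finally show ?thesis .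
    qed
  qed auto
qed

lemma wright_g_eq:
  assumes "t > 0"
  shows "wright_g \<beta> x t = t powr (- \<beta>) * wright_M \<beta> (t powr (- \<beta>) * x)"
proof -
  have "(- x) ^ k * rGamma (1 - \<beta> * (real k + 1)) / (t powr (\<beta> * real k) * fact k)
      = (- (t powr (- \<beta>) * x)) ^ k * rGamma (1 - \<beta> * (real k + 1)) / fact k" for k
  proof -
    have "t powr (\<beta> * real k) = (t powr \<beta>) ^ k"
      using assms by (simp add: powr_powr[symmetric] powr_realpow)
    moreover have "(- (t powr (- \<beta>) * x)) ^ k = (- x) ^ k / (t powr \<beta>) ^ k"
      by (simp add: powr_minus_divide power_divide[symmetric])
    ultimately show ?thesis by simp
  qed
  then show ?thesis
    by (simp add: wright_g_def wright_M_def powr_minus_divide)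
qed

context
  fixes \<beta> :: real
  assumes \<beta>: "0 < \<beta>" "\<beta> < 1"
begin

text \<open>Index 0 belongs to the transform itself, index 1 to its derivative in the scale, where
  the chain rule brings down y. Since the weight vanishes for y < 0, functions can be evaluated at
  multiples of |y|, giving the nonnegative argument that the moment lemmas require on the entire
  space.\<close>

definition weight :: "nat \<Rightarrow> real \<Rightarrow> real" where
  "weight j y = indicator {0..} y * (y ^ j * wright_M \<beta> y)"

lemma weight_measurable [measurable]: "weight j \<in> borel_measurable borel"
  unfolding weight_def[abs_def] by measurable

lemma weight_exp_integrable: "integrable lborel (\<lambda>y. weight j y * exp (c * \<bar>y\<bar>))"
proof -
  \<comment> \<open>Of the rate c + 2, the part c cancels the given exponential, one unit absorbs
    y^j, and one unit remains for integrability.\<close>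
  obtain K where K: "K \<ge> 0" "\<And>y. y \<ge> 0 \<Longrightarrow> \<bar>wright_M \<beta> y\<bar> \<le> K * exp (- ((c + 2) * y))"
    using wright_M_decay[OF \<beta>] by blast
  show ?thesis
  proof (rule Bochner_Integration.integrable_bound)
    show "integrable lborel (\<lambda>y. indicator {0..} y *\<^sub>R (fact j * K * exp (- 1 * y)))"
      using set_integrable_mult_right[OF set_integrable_exp_neg[of 1], of "fact j * K"]
      by (simp add: set_integrable_def)
    show "AE y in lborel. norm (weight j y * exp (c * \<bar>y\<bar>)) \<le> norm (indicator {0..} y *\<^sub>R (fact j * K * exp (- 1 * y)))"
    proof (intro AE_I2)
      fix y :: real
      show "norm (weight j y * exp (c * \<bar>y\<bar>)) \<le> norm (indicator {0..} y *\<^sub>R (fact j * K * exp (- 1 * y)))"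
      proof (cases "y \<ge> 0")
        case True
        have "y ^ j * \<bar>wright_M \<beta> y\<bar> * exp (c * y) \<le> (fact j * exp y) * (K * exp (- ((c + 2) * y))) * exp (c * y)"
          using power_le_exp[of 1 y j] True K by (intro mult_right_mono mult_mono) auto
        also have "\<dots> = fact j * K * (exp y * exp (- ((c + 2) * y)) * exp (c * y))" by simp
        also have "exp y * exp (- ((c + 2) * y)) * exp (c * y) = exp (- 1 * y)"
          unfolding mult_exp_exp by (rule arg_cong[of _ _ exp]) (simp add: algebra_simps)
        finally show ?thesis
          using True K(1) by (simp add: weight_def abs_mult)
      qed (simp add: weight_def)
    qed
  qed measurable
qed

lemma weight_scaled_integrable:
  assumes k: "continuous_on {0..} k" and bound: "\<And>x. x \<ge> 0 \<Longrightarrow> \<bar>k x\<bar> \<le> S * exp (c * x)" and a: "a \<ge> 0"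
  shows "integrable lborel (\<lambda>y. weight j y * k (a * \<bar>y\<bar>))"
proof (rule exp_bounded_integrable[where \<psi> = "\<lambda>y. a * \<bar>y\<bar>", OF _ _ _ _ k bound])
  show "integrable lborel (\<lambda>y. weight j y * exp (c * (a * \<bar>y\<bar>)))" for c
    using weight_exp_integrable[of j "c * a"] by (simp add: mult.assoc)
qed (use a in auto)

lemma weight_moment: "(\<integral>y. weight j y * \<bar>y\<bar> ^ m \<partial>lborel) = fact (j + m) * rGamma (1 + \<beta> * real (j + m))"
proof -
  have "(\<integral>y. weight j y * \<bar>y\<bar> ^ m \<partial>lborel) = (LINT y:{0..}|lborel. y ^ (j + m) * wright_M \<beta> y)"
    unfolding set_lebesgue_integral_def
    by (intro Bochner_Integration.integral_cong) (auto simp: weight_def indicator_def power_add)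
  then show ?thesis using wright_M_moments[OF \<beta>] by simp
qed

text \<open>The substitution s = t^\<beta> y moves t out of the density into the argument of k,
  where it can be differentiated.\<close>

lemma wright_transform_eq:
  assumes k: "continuous_on {0..} k" "exp_order k" and t: "t > 0"
  shows "set_integrable lborel {0..} (\<lambda>s. wright_g \<beta> s t * k s)"
    and "wright_transform \<beta> k t = (\<integral>y. weight 0 y * k (t powr \<beta> * \<bar>y\<bar>) \<partial>lborel)"
proof -
  obtain S c where bound: "\<And>x. x \<ge> 0 \<Longrightarrow> \<bar>k x\<bar> \<le> S * exp (c * x)"
    using exp_order_imp_bound[OF k] by metis
  define f where "f s = indicator {0..} s *\<^sub>R (wright_g \<beta> s t * k s)" for s
  have pos: "t powr \<beta> > 0" using t by simp
  have f_scaled: "f (0 + t powr \<beta> * y) = t powr (- \<beta>) * (weight 0 y * k (t powr \<beta> * \<bar>y\<bar>))" for y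
  proof (cases "y \<ge> 0")
    case True
    have "t powr (- \<beta>) * (t powr \<beta> * y) = y"
      using t by (simp add: mult.assoc[symmetric] powr_add[symmetric])
    then have "wright_g \<beta> (t powr \<beta> * y) t = t powr (- \<beta>) * wright_M \<beta> y"
      by (simp only: wright_g_eq[OF t])
    then show ?thesis
      using True pos by (simp add: f_def weight_def zero_le_mult_iff)
  next
    case False
    then show ?thesis using pos by (simp add: f_def weight_def zero_le_mult_iff)
  qed
  have int: "integrable lborel (\<lambda>y. weight 0 y * k (t powr \<beta> * \<bar>y\<bar>))"
    by (rule weight_scaled_integrable[OF k(1) bound]) auto
  then have "integrable lborel (\<lambda>y. f (0 + t powr \<beta> * y))"
    unfolding f_scaled by (rule integrable_mult_right)
  then show set_int: "set_integrable lborel {0..} (\<lambda>s. wright_g \<beta> s t * k s)"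
    using pos by (subst (asm) lborel_integrable_real_affine_iff) (auto simp: set_integrable_def f_def[abs_def])
  have "wright_transform \<beta> k t = (\<integral>s. f s \<partial>lborel)"
    using t set_borel_integral_eq_integral(2)[OF set_int]
    by (simp add: wright_transform_def right_ext_def set_lebesgue_integral_def f_def)
  also have "\<dots> = \<bar>t powr \<beta>\<bar> *\<^sub>R (\<integral>y. f (0 + t powr \<beta> * y) \<partial>lborel)"
    using pos by (intro lborel_integral_real_affine) auto
  also have "\<dots> = (t powr \<beta> * t powr (- \<beta>)) * (\<integral>y. weight 0 y * k (t powr \<beta> * \<bar>y\<bar>) \<partial>lborel)"
    unfolding f_scaled by simp
  also have "t powr \<beta> * t powr (- \<beta>) = 1"
    using t by (simp add: powr_add[symmetric])
  finally show "wright_transform \<beta> k t = (\<integral>y. weight 0 y * k (t powr \<beta> * \<bar>y\<bar>) \<partial>lborel)" by simp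
qed

text \<open>The mean value inequality bounds the difference quotients of h (s |y|) by |y| times an
  exponential of |y|, which the weight integrates; dominated convergence then gives the
  derivative.\<close>

lemma weight_integral_deriv:
  assumes h: "\<And>x. x \<ge> 0 \<Longrightarrow> (h has_real_derivative k x) (at x within {0..})"
    and k: "continuous_on {0..} k" and k_bound: "\<And>x. x \<ge> 0 \<Longrightarrow> \<bar>k x\<bar> \<le> S * exp (c * x)"
    and h_bound: "\<And>x. x \<ge> 0 \<Longrightarrow> \<bar>h x\<bar> \<le> S' * exp (c' * x)"
    and c: "c \<ge> 0" and S: "S \<ge> 0" and \<sigma>: "\<sigma> > 0"
  shows "((\<lambda>s. \<integral>y. weight 0 y * h (s * \<bar>y\<bar>) \<partial>lborel) has_real_derivative
      (\<integral>y. weight 1 y * k (\<sigma> * \<bar>y\<bar>) \<partial>lborel)) (at \<sigma>)"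
proof -
  \<comment> \<open>Bounded above, so that one exponential rate serves all s; bounded below by 0, so
    that h is only evaluated on its half-line.\<close>
  define A where "A = {0<..<\<sigma> + 1}"
  define U where "U s = (\<integral>y. weight 0 y * h (s * \<bar>y\<bar>) \<partial>lborel)" for s
  have h_cont: "continuous_on {0..} h"
    using DERIV_continuous_on[of "{0..}" h k] h by auto
  have h_int: "integrable lborel (\<lambda>y. weight 0 y * h (s * \<bar>y\<bar>))" if "s \<ge> 0" for s
    by (rule weight_scaled_integrable[OF h_cont h_bound that])
  have k_int: "integrable lborel (\<lambda>y. weight 1 y * k (s * \<bar>y\<bar>))" if "s \<ge> 0" for s
    by (rule weight_scaled_integrable[OF k k_bound that])
  have lipschitz: "\<bar>h (s * \<bar>y\<bar>) - h (\<sigma> * \<bar>y\<bar>)\<bar> \<le> S * exp (c * ((\<sigma> + 1) * \<bar>y\<bar>)) * (\<bar>s - \<sigma>\<bar> * \<bar>y\<bar>)"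
    if "s \<in> A" for s y
  proof -
    have "norm (h (s * \<bar>y\<bar>) - h (\<sigma> * \<bar>y\<bar>)) \<le> S * exp (c * ((\<sigma> + 1) * \<bar>y\<bar>)) * norm (s * \<bar>y\<bar> - \<sigma> * \<bar>y\<bar>)"
    proof (rule field_differentiable_bound[of "{0..(\<sigma> + 1) * \<bar>y\<bar>}" h k])
      show "(h has_real_derivative k z) (at z within {0..(\<sigma> + 1) * \<bar>y\<bar>})" if "z \<in> {0..(\<sigma> + 1) * \<bar>y\<bar>}" for z
        by (rule DERIV_subset[OF h]) (use that in auto)
      show "norm (k z) \<le> S * exp (c * ((\<sigma> + 1) * \<bar>y\<bar>))" if "z \<in> {0..(\<sigma> + 1) * \<bar>y\<bar>}" for z
      proof -
        have "c * z \<le> c * ((\<sigma> + 1) * \<bar>y\<bar>)" using that c by (intro mult_left_mono) auto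
        then have "S * exp (c * z) \<le> S * exp (c * ((\<sigma> + 1) * \<bar>y\<bar>))" using S by (intro mult_left_mono) auto
        then show ?thesis using k_bound[of z] that by simp
      qed
    qed (use that \<sigma> in \<open>auto simp: A_def intro!: mult_right_mono\<close>)
    moreover have "s * \<bar>y\<bar> - \<sigma> * \<bar>y\<bar> = (s - \<sigma>) * \<bar>y\<bar>" by (simp add: left_diff_distrib)
    ultimately show ?thesis by (simp add: abs_mult)
  qed
  have pointwise: "((\<lambda>s. weight 0 y * ((h (s * \<bar>y\<bar>) - h (\<sigma> * \<bar>y\<bar>)) / (s - \<sigma>))) \<longlongrightarrow> weight 1 y * k (\<sigma> * \<bar>y\<bar>)) (at \<sigma> within A)" for y
  proof (cases "y > 0")
    case True
    have "\<sigma> * y > 0" using True \<sigma> by simp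
    then have "at (\<sigma> * y) within {0..} = at (\<sigma> * y)" by (intro at_within_interior) simp
    then have "(h has_real_derivative k (\<sigma> * y)) (at (\<sigma> * y))"
      using h[of "\<sigma> * y"] \<open>\<sigma> * y > 0\<close> by simp
    moreover have "((\<lambda>s. s * y) has_real_derivative y) (at \<sigma>)"
      by (auto intro!: derivative_eq_intros)
    ultimately have "((\<lambda>s. h (s * y)) has_real_derivative k (\<sigma> * y) * y) (at \<sigma>)"
      by (rule DERIV_chain2)
    then have "((\<lambda>s. (h (s * y) - h (\<sigma> * y)) / (s - \<sigma>)) \<longlongrightarrow> k (\<sigma> * y) * y) (at \<sigma> within A)"
      unfolding has_field_derivative_iff by (rule tendsto_within_subset) auto
    from tendsto_mult_left[OF this, of "weight 0 y"] True show ?thesis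
      by (simp add: weight_def mult_ac)
  qed (auto simp: weight_def indicator_def)
  have "((\<lambda>s. (U s - U \<sigma>) / (s - \<sigma>)) \<longlongrightarrow> (\<integral>y. weight 1 y * k (\<sigma> * \<bar>y\<bar>) \<partial>lborel)) (at \<sigma> within A)"
    unfolding tendsto_at_iff_sequentially
  proof (intro allI impI)
    fix X :: "nat \<Rightarrow> real" assume X: "\<forall>i. X i \<in> A - {\<sigma>}" "X \<longlonglongrightarrow> \<sigma>"
    then have X': "X i \<in> A" "X i \<noteq> \<sigma>" "X i \<ge> 0" for i by (auto simp: A_def intro: less_imp_le)
    have "(\<lambda>i. \<integral>y. weight 0 y * ((h (X i * \<bar>y\<bar>) - h (\<sigma> * \<bar>y\<bar>)) / (X i - \<sigma>)) \<partial>lborel)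
        \<longlonglongrightarrow> (\<integral>y. weight 1 y * k (\<sigma> * \<bar>y\<bar>) \<partial>lborel)"
    proof (rule integral_dominated_convergence)
      show "(\<lambda>y. weight 1 y * k (\<sigma> * \<bar>y\<bar>)) \<in> borel_measurable lborel"
        using k_int[of \<sigma>] \<sigma> by auto
      have "integrable lborel (\<lambda>y. (weight 0 y * h (X i * \<bar>y\<bar>) - weight 0 y * h (\<sigma> * \<bar>y\<bar>)) / (X i - \<sigma>))" for i
        using X' \<sigma> by (intro integrable_divide Bochner_Integration.integrable_diff h_int) auto
      then show "(\<lambda>y. weight 0 y * ((h (X i * \<bar>y\<bar>) - h (\<sigma> * \<bar>y\<bar>)) / (X i - \<sigma>))) \<in> borel_measurable lborel" for i
        by (simp add: right_diff_distrib borel_measurable_integrable)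
      show "integrable lborel (\<lambda>y. S * \<bar>weight 1 y * exp (c * (\<sigma> + 1) * \<bar>y\<bar>)\<bar>)"
        by (intro integrable_mult_right integrable_abs weight_exp_integrable)
      show "AE y in lborel. (\<lambda>i. weight 0 y * ((h (X i * \<bar>y\<bar>) - h (\<sigma> * \<bar>y\<bar>)) / (X i - \<sigma>))) \<longlonglongrightarrow> weight 1 y * k (\<sigma> * \<bar>y\<bar>)"
        using pointwise X unfolding tendsto_at_iff_sequentially o_def by (intro AE_I2) blast
      show "AE y in lborel. norm (weight 0 y * ((h (X i * \<bar>y\<bar>) - h (\<sigma> * \<bar>y\<bar>)) / (X i - \<sigma>))) \<le> S * \<bar>weight 1 y * exp (c * (\<sigma> + 1) * \<bar>y\<bar>)\<bar>" for i
      proof (intro AE_I2)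
        fix y
        have "\<bar>h (X i * \<bar>y\<bar>) - h (\<sigma> * \<bar>y\<bar>)\<bar> / \<bar>X i - \<sigma>\<bar> \<le> S * exp (c * ((\<sigma> + 1) * \<bar>y\<bar>)) * \<bar>y\<bar>"
          using lipschitz[OF X'(1), of i y] X'(2)[of i] by (simp add: divide_le_eq mult_ac)
        from mult_left_mono[OF this, of "\<bar>weight 0 y\<bar>"]
        have "norm (weight 0 y * ((h (X i * \<bar>y\<bar>) - h (\<sigma> * \<bar>y\<bar>)) / (X i - \<sigma>))) \<le> \<bar>weight 0 y\<bar> * (S * exp (c * ((\<sigma> + 1) * \<bar>y\<bar>)) * \<bar>y\<bar>)"
          by (simp add: abs_mult abs_divide)
        also have "\<dots> = S * \<bar>weight 1 y * exp (c * (\<sigma> + 1) * \<bar>y\<bar>)\<bar>"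
          by (simp add: weight_def abs_mult mult_ac)
        finally show "norm (weight 0 y * ((h (X i * \<bar>y\<bar>) - h (\<sigma> * \<bar>y\<bar>)) / (X i - \<sigma>))) \<le> S * \<bar>weight 1 y * exp (c * (\<sigma> + 1) * \<bar>y\<bar>)\<bar>" .
      qed
    qed
    moreover have "(\<integral>y. weight 0 y * ((h (X i * \<bar>y\<bar>) - h (\<sigma> * \<bar>y\<bar>)) / (X i - \<sigma>)) \<partial>lborel) = (U (X i) - U \<sigma>) / (X i - \<sigma>)" for i
    proof -
      have "(\<integral>y. weight 0 y * ((h (X i * \<bar>y\<bar>) - h (\<sigma> * \<bar>y\<bar>)) / (X i - \<sigma>)) \<partial>lborel)
          = (\<integral>y. (weight 0 y * h (X i * \<bar>y\<bar>) - weight 0 y * h (\<sigma> * \<bar>y\<bar>)) / (X i - \<sigma>) \<partial>lborel)"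
        by (simp add: right_diff_distrib)
      also have "\<dots> = (U (X i) - U \<sigma>) / (X i - \<sigma>)"
        using h_int[of "X i"] h_int[of \<sigma>] X'(3) \<sigma> by (simp add: U_def)
      finally show ?thesis .
    qed
    ultimately show "((\<lambda>s. (U s - U \<sigma>) / (s - \<sigma>)) \<circ> X) \<longlonglongrightarrow> (\<integral>y. weight 1 y * k (\<sigma> * \<bar>y\<bar>) \<partial>lborel)"
      by (simp only: o_def)
  qed
  then have "(U has_real_derivative (\<integral>y. weight 1 y * k (\<sigma> * \<bar>y\<bar>) \<partial>lborel)) (at \<sigma> within A)"
    by (simp only: has_field_derivative_iff)
  then show ?thesis
    unfolding U_def using \<sigma> by (subst (asm) at_within_open) (auto simp: A_def)
qed

text \<open>The Caputo kernel multiplied by the factor \<beta> \<tau>^(\<beta> - 1) from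
  differentiating \<tau>^\<beta>, cut off to the open interval.\<close>

definition abel_kernel :: "real \<Rightarrow> real \<Rightarrow> real" where
  "abel_kernel t \<tau> = indicator {0<..<t} \<tau> * ((t - \<tau>) powr (- \<beta>) * (\<beta> * \<tau> powr (\<beta> - 1))) / Gamma (1 - \<beta>)"

lemma abel_kernel_measurable [measurable]: "abel_kernel t \<in> borel_measurable borel"
  unfolding abel_kernel_def[abs_def] by measurable

text \<open>The substitution \<tau> = t x yields the Beta integral with parameters \<beta> (m + 1)
  and 1 - \<beta>, and the normalising Gamma (1 - \<beta>) cancels.\<close>

lemma abel_kernel_moment:
  assumes t: "t > 0"
  shows "integrable lborel (\<lambda>\<tau>. abel_kernel t \<tau> * (\<tau> powr \<beta>) ^ m)" (is ?int)
    and "(\<integral>\<tau>. abel_kernel t \<tau> * (\<tau> powr \<beta>) ^ m \<partial>lborel)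
      = (t powr \<beta>) ^ m * (\<beta> * Gamma (\<beta> * (real m + 1)) * rGamma (1 + \<beta> * real m))" (is ?val)
proof -
  define a where "a = \<beta> * (real m + 1)"
  have a: "a > 0" using \<beta> by (simp add: a_def)
  define b where "b x = indicator {0..1} x *\<^sub>R (x powr (a - 1) * (1 - x) powr (1 - \<beta> - 1))" for x :: real
  have b_int: "integrable lborel b"
    using integrable_Beta[of a "1 - \<beta>"] a \<beta> by (simp add: set_integrable_def b_def[abs_def])
  have b_val: "(\<integral>x. b x \<partial>lborel) = Beta a (1 - \<beta>)"
  proof -
    have "set_integrable lborel {0..1} (\<lambda>x. x powr (a - 1) * (1 - x) powr (1 - \<beta> - 1))"
      using integrable_Beta[of a "1 - \<beta>"] a \<beta> by simp
    from set_borel_integral_eq_integral(2)[OF this] show ?thesis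
      using integral_unique[OF has_integral_Beta_real[of a "1 - \<beta>"]] a \<beta>
      by (simp add: b_def set_lebesgue_integral_def)
  qed
  define f where "f \<tau> = abel_kernel t \<tau> * (\<tau> powr \<beta>) ^ m" for \<tau>
  have f_scaled: "f (0 + t * x) = (\<beta> * (t powr \<beta>) ^ m / (t * Gamma (1 - \<beta>))) * b x" for x
  proof (cases "x \<in> {0<..<1}")
    case True
    have "(t * x) powr (\<beta> - 1) * ((t * x) powr \<beta>) ^ m = (t * x) powr (a - 1)"
      using True t by (simp add: powr_realpow[symmetric] powr_powr powr_add[symmetric] a_def algebra_simps)
    also have "\<dots> = t powr (a - 1) * x powr (a - 1)"
      using True t by (simp add: powr_mult)
    finally have 1: "(t * x) powr (\<beta> - 1) * ((t * x) powr \<beta>) ^ m = t powr (a - 1) * x powr (a - 1)" .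
    have "t - t * x = t * (1 - x)" by (simp add: algebra_simps)
    then have 2: "(t - t * x) powr (- \<beta>) = t powr (- \<beta>) * (1 - x) powr (- \<beta>)"
      using True t by (simp add: powr_mult)
    have "t powr (- \<beta>) * t powr (a - 1) = t powr (\<beta> * real m - 1)"
      by (simp add: powr_add[symmetric] a_def algebra_simps)
    also have "\<dots> = (t powr \<beta>) ^ m / t"
      using t by (simp add: powr_diff powr_powr[symmetric] powr_realpow)
    finally have 3: "t powr (- \<beta>) * t powr (a - 1) = (t powr \<beta>) ^ m / t" .
    have "f (0 + t * x) = ((t - t * x) powr (- \<beta>) * \<beta> * ((t * x) powr (\<beta> - 1) * ((t * x) powr \<beta>) ^ m)) / Gamma (1 - \<beta>)"
      using True t by (simp add: f_def abel_kernel_def)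
    also have "\<dots> = (t powr (- \<beta>) * t powr (a - 1)) * (\<beta> * (x powr (a - 1) * (1 - x) powr (- \<beta>)) / Gamma (1 - \<beta>))"
      unfolding 1 2 by simp
    finally show ?thesis
      unfolding 3 using True by (simp add: b_def)
  next
    case False
    then have "t * x \<notin> {0<..<t}"
      using t by (auto simp: zero_less_mult_iff)
    moreover have "b x = 0" using False by (auto simp: b_def indicator_def not_less)
    ultimately show ?thesis by (simp add: f_def abel_kernel_def)
  qed
  have "integrable lborel (\<lambda>x. f (0 + t * x))"
    unfolding f_scaled by (intro integrable_mult_right b_int)
  then show ?int
    using t by (subst (asm) lborel_integrable_real_affine_iff) (auto simp: f_def[abs_def])
  have G: "Gamma (1 - \<beta>) > 0" using \<beta> by simp
  have "(\<integral>\<tau>. f \<tau> \<partial>lborel) = \<bar>t\<bar> *\<^sub>R (\<integral>x. f (0 + t * x) \<partial>lborel)"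
    using t by (intro lborel_integral_real_affine) auto
  also have "\<dots> = \<beta> * (t powr \<beta>) ^ m / Gamma (1 - \<beta>) * Beta a (1 - \<beta>)"
    unfolding f_scaled using t by (simp add: b_val)
  also have "Beta a (1 - \<beta>) = Gamma a * Gamma (1 - \<beta>) * rGamma (1 + \<beta> * real m)"
    unfolding Beta_altdef by (simp add: a_def algebra_simps)
  finally show ?val
    using G by (simp add: f_def a_def)
qed

text \<open>Both sides are integrals of \<open>k\<close> against signed weights with all exponential moments, on
  \<open>(\<tau>, y)\<close>-space and on the half-line, so only their moments have to be compared.\<close>

lemma caputo_integral_eq:
  assumes t: "t > 0" and k: "continuous_on {0..} k" and bound: "\<And>x. x \<ge> 0 \<Longrightarrow> \<bar>k x\<bar> \<le> S * exp (c * x)"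
  shows "integrable lborel (\<lambda>\<tau>. abel_kernel t \<tau> * (\<integral>y. weight 1 y * k (\<tau> powr \<beta> * \<bar>y\<bar>) \<partial>lborel))"
    and "(\<integral>\<tau>. abel_kernel t \<tau> * (\<integral>y. weight 1 y * k (\<tau> powr \<beta> * \<bar>y\<bar>) \<partial>lborel) \<partial>lborel)
      = (\<integral>y. weight 0 y * k (t powr \<beta> * \<bar>y\<bar>) \<partial>lborel)"
proof -
  define W where "W = (\<lambda>(\<tau>, y). abel_kernel t \<tau> * weight 1 y)"
  define \<psi> where "\<psi> = (\<lambda>(\<tau>, y). \<tau> powr \<beta> * \<bar>y\<bar> :: real)"
  have W_meas [measurable]: "W \<in> borel_measurable (lborel \<Otimes>\<^sub>M lborel)"
    unfolding W_def by measurable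
  have \<psi>_meas [measurable]: "\<psi> \<in> borel_measurable (lborel \<Otimes>\<^sub>M lborel)"
    unfolding \<psi>_def by measurable
  have \<psi>_nonneg: "\<psi> x \<ge> 0" for x by (cases x) (simp add: \<psi>_def)
  have kernel_int: "integrable lborel (abel_kernel t)"
    using abel_kernel_moment(1)[OF t, of 0] by simp
  have W_int: "integrable (lborel \<Otimes>\<^sub>M lborel) (\<lambda>x. W x * exp (s * \<psi> x))" for s
  proof (rule Bochner_Integration.integrable_bound)
    \<comment> \<open>On the support of the kernel \<tau> < t, hence \<psi> \<le> t^\<beta> |y|;
      replacing \<psi> by this separates the two variables.\<close>
    show "integrable (lborel \<Otimes>\<^sub>M lborel) (\<lambda>(\<tau>, y). abel_kernel t \<tau> * (weight 1 y * exp (\<bar>s\<bar> * t powr \<beta> * \<bar>y\<bar>)))"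
      by (intro integrable_product sigma_finite_lborel kernel_int weight_exp_integrable)
    show "AE x in lborel \<Otimes>\<^sub>M lborel. norm (W x * exp (s * \<psi> x))
        \<le> norm (case x of (\<tau>, y) \<Rightarrow> abel_kernel t \<tau> * (weight 1 y * exp (\<bar>s\<bar> * t powr \<beta> * \<bar>y\<bar>)))"
    proof (intro AE_I2, clarify)
      fix \<tau> y :: real
      show "norm (W (\<tau>, y) * exp (s * \<psi> (\<tau>, y))) \<le> norm (abel_kernel t \<tau> * (weight 1 y * exp (\<bar>s\<bar> * t powr \<beta> * \<bar>y\<bar>)))"
      proof (cases "\<tau> \<in> {0<..<t}")
        case True
        have "s * (\<tau> powr \<beta> * \<bar>y\<bar>) \<le> \<bar>s\<bar> * (t powr \<beta> * \<bar>y\<bar>)"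
          using True \<beta> by (intro mult_mono powr_mono2) auto
        then have "exp (s * (\<tau> powr \<beta> * \<bar>y\<bar>)) \<le> exp (\<bar>s\<bar> * t powr \<beta> * \<bar>y\<bar>)" by (simp add: mult.assoc)
        then have "\<bar>abel_kernel t \<tau> * weight 1 y\<bar> * exp (s * (\<tau> powr \<beta> * \<bar>y\<bar>)) \<le> \<bar>abel_kernel t \<tau> * weight 1 y\<bar> * exp (\<bar>s\<bar> * t powr \<beta> * \<bar>y\<bar>)"
          by (rule mult_left_mono) simp
        then show ?thesis by (simp add: W_def \<psi>_def abs_mult mult.assoc)
      qed (simp add: W_def abel_kernel_def)
    qed
  qed measurable
  have weight_int: "integrable lborel (\<lambda>y. weight 0 y * exp (s * (t powr \<beta> * \<bar>y\<bar>)))" for s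
    using weight_exp_integrable[of 0 "s * t powr \<beta>"] by (simp add: mult.assoc)
  have moments: "(\<integral>x. W x * \<psi> x ^ m \<partial>(lborel \<Otimes>\<^sub>M lborel)) = (\<integral>y. weight 0 y * (t powr \<beta> * \<bar>y\<bar>) ^ m \<partial>lborel)" for m
  proof -
    have "(\<integral>x. W x * \<psi> x ^ m \<partial>(lborel \<Otimes>\<^sub>M lborel)) = (\<integral>\<tau>. (\<integral>y. W (\<tau>, y) * \<psi> (\<tau>, y) ^ m \<partial>lborel) \<partial>lborel)"
      by (rule lborel_pair.integral_fst'[symmetric, OF moments_integrable[OF W_meas \<psi>_meas \<psi>_nonneg W_int]])
    also have "\<dots> = (\<integral>\<tau>. (abel_kernel t \<tau> * (\<tau> powr \<beta>) ^ m) * (\<integral>y. weight 1 y * \<bar>y\<bar> ^ m \<partial>lborel) \<partial>lborel)"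
      unfolding integral_mult_right_zero[symmetric]
      by (simp add: W_def \<psi>_def power_mult_distrib mult_ac)
    also have "\<dots> = (t powr \<beta>) ^ m * (\<beta> * Gamma (\<beta> * (real m + 1)) * rGamma (1 + \<beta> * real m)) * (fact (1 + m) * rGamma (1 + \<beta> * real (1 + m)))"
      unfolding integral_mult_left_zero abel_kernel_moment(2)[OF t] weight_moment ..
    \<comment> \<open>The factor m + 1 split off from (m + 1)! joins \<beta>, so that \<Gamma>(x +
      1) = x \<Gamma>(x) at x = \<beta> (m + 1) cancels everything except the m-th moment of
      \<open>wright_M\<close>.\<close>
    also have "\<dots> = (t powr \<beta>) ^ m * (fact m * rGamma (1 + \<beta> * real m)) * ((\<beta> * (real m + 1) * rGamma (\<beta> * (real m + 1) + 1)) * Gamma (\<beta> * (real m + 1)))"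
      by (simp add: add.commute mult_ac)
    also have "\<beta> * (real m + 1) * rGamma (\<beta> * (real m + 1) + 1) = rGamma (\<beta> * (real m + 1))"
      by (rule rGamma_plus1)
    also have "rGamma (\<beta> * (real m + 1)) * Gamma (\<beta> * (real m + 1)) = 1"
    proof -
      have "\<beta> * (real m + 1) > 0" using \<beta> by simp
      from Gamma_real_pos[OF this] show ?thesis
        by (simp add: rGamma_inverse_Gamma del: Gamma_real_pos)
    qed
    also have "(t powr \<beta>) ^ m * (fact m * rGamma (1 + \<beta> * real m)) * 1 = (\<integral>y. (t powr \<beta>) ^ m * (weight 0 y * \<bar>y\<bar> ^ m) \<partial>lborel)"
      unfolding integral_mult_right_zero weight_moment by simp
    finally show ?thesis by (simp add: power_mult_distrib mult_ac)
  qed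
  have int: "integrable (lborel \<Otimes>\<^sub>M lborel) (\<lambda>x. W x * k (\<psi> x))"
    by (rule exp_bounded_integrable[OF W_meas \<psi>_meas \<psi>_nonneg W_int k bound])
  have inner: "(\<integral>y. W (\<tau>, y) * k (\<psi> (\<tau>, y)) \<partial>lborel) = abel_kernel t \<tau> * (\<integral>y. weight 1 y * k (\<tau> powr \<beta> * \<bar>y\<bar>) \<partial>lborel)" for \<tau>
    unfolding integral_mult_right_zero[symmetric] by (simp add: W_def \<psi>_def mult.assoc)
  show "integrable lborel (\<lambda>\<tau>. abel_kernel t \<tau> * (\<integral>y. weight 1 y * k (\<tau> powr \<beta> * \<bar>y\<bar>) \<partial>lborel))"
    using lborel_pair.integrable_fst'[OF int] unfolding inner .
  have "(\<integral>\<tau>. abel_kernel t \<tau> * (\<integral>y. weight 1 y * k (\<tau> powr \<beta> * \<bar>y\<bar>) \<partial>lborel) \<partial>lborel) = (\<integral>x. W x * k (\<psi> x) \<partial>(lborel \<Otimes>\<^sub>M lborel))"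
    using lborel_pair.integral_fst'[OF int] unfolding inner .
  also have "\<dots> = (\<integral>y. weight 0 y * k (t powr \<beta> * \<bar>y\<bar>) \<partial>lborel)"
    by (rule moments_determine_integral[OF W_meas \<psi>_meas \<psi>_nonneg W_int _ _ _ weight_int moments k bound]) auto
  finally show "(\<integral>\<tau>. abel_kernel t \<tau> * (\<integral>y. weight 1 y * k (\<tau> powr \<beta> * \<bar>y\<bar>) \<partial>lborel) \<partial>lborel)
      = (\<integral>y. weight 0 y * k (t powr \<beta> * \<bar>y\<bar>) \<partial>lborel)" .
qed

text \<open>The function u is tied to the transform only at positive times. The lemma can therefore
  be applied to iterates, whose value at 0 is a right limit not computed here.\<close>

lemma caputo_wright_transform:
  assumes h: "\<And>x. x \<ge> 0 \<Longrightarrow> (h has_real_derivative k x) (at x within {0..})"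
    and k: "continuous_on {0..} k" and exp_h: "exp_order h" and exp_k: "exp_order k"
    and u: "\<And>t. t > 0 \<Longrightarrow> u t = wright_transform \<beta> h t" and t: "t > 0"
  shows "caputo \<beta> u t = wright_transform \<beta> k t"
proof -
  have h_cont: "continuous_on {0..} h"
    using DERIV_continuous_on[of "{0..}" h k] h by auto
  obtain S c where S: "S \<ge> 0" "c \<ge> 0" and k_bound: "\<And>x. x \<ge> 0 \<Longrightarrow> \<bar>k x\<bar> \<le> S * exp (c * x)"
    using exp_order_imp_bound[OF k exp_k] by metis
  obtain S' c' where h_bound: "\<And>x. x \<ge> 0 \<Longrightarrow> \<bar>h x\<bar> \<le> S' * exp (c' * x)"
    using exp_order_imp_bound[OF h_cont exp_h] by metis
  define V where "V \<tau> = (\<integral>y. weight 1 y * k (\<tau> powr \<beta> * \<bar>y\<bar>) \<partial>lborel)" for \<tau>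
  have deriv_u: "deriv u \<tau> = \<beta> * \<tau> powr (\<beta> - 1) * V \<tau>" if \<tau>: "\<tau> > 0" for \<tau>
  proof (rule DERIV_imp_deriv)
    have "((\<lambda>\<tau>. \<tau> powr \<beta>) has_real_derivative \<beta> * \<tau> powr (\<beta> - 1)) (at \<tau>)"
      using \<tau> by (auto intro!: derivative_eq_intros)
    moreover have "((\<lambda>s. \<integral>y. weight 0 y * h (s * \<bar>y\<bar>) \<partial>lborel) has_real_derivative V \<tau>) (at (\<tau> powr \<beta>))"
      unfolding V_def using \<tau> S by (intro weight_integral_deriv[OF h k k_bound h_bound]) auto
    ultimately have "((\<lambda>\<tau>. \<integral>y. weight 0 y * h (\<tau> powr \<beta> * \<bar>y\<bar>) \<partial>lborel) has_real_derivative V \<tau> * (\<beta> * \<tau> powr (\<beta> - 1))) (at \<tau>)"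
      by (intro DERIV_chain2[where f = "\<lambda>s. \<integral>y. weight 0 y * h (s * \<bar>y\<bar>) \<partial>lborel" and g = "\<lambda>\<tau>. \<tau> powr \<beta>"])
    then have "(u has_real_derivative V \<tau> * (\<beta> * \<tau> powr (\<beta> - 1))) (at \<tau>)"
    proof (rule has_field_derivative_transform_within_open[where S = "{0<..}"])
      show "(\<integral>y. weight 0 y * h (x powr \<beta> * \<bar>y\<bar>) \<partial>lborel) = u x" if "x \<in> {0<..}" for x
        using that u[of x] wright_transform_eq(2)[OF h_cont exp_h, of x] by simp
    qed (use \<tau> in auto)
    then show "(u has_real_derivative \<beta> * \<tau> powr (\<beta> - 1) * V \<tau>) (at \<tau>)"
      by (simp add: mult.commute)
  qed
  define f where "f \<tau> = (t - \<tau>) powr (- \<beta>) * deriv u \<tau>" for \<tau>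
  \<comment> \<open>The open interval avoids \<open>deriv u 0\<close>, which the values of u at
    positive times do not determine; the endpoints do not affect the integral.\<close>
  have f_eq: "indicator {0<..<t} \<tau> *\<^sub>R (1 / Gamma (1 - \<beta>) * f \<tau>) = abel_kernel t \<tau> * V \<tau>" for \<tau>
    by (cases "\<tau> \<in> {0<..<t}") (auto simp: f_def abel_kernel_def deriv_u)
  have "set_integrable lborel {0<..<t} (\<lambda>\<tau>. 1 / Gamma (1 - \<beta>) * f \<tau>)"
    unfolding set_integrable_def f_eq V_def by (rule caputo_integral_eq(1)[OF t k k_bound])
  from set_borel_integral_eq_integral(2)[OF this]
  have "integral {0<..<t} (\<lambda>\<tau>. 1 / Gamma (1 - \<beta>) * f \<tau>) = (\<integral>\<tau>. abel_kernel t \<tau> * V \<tau> \<partial>lborel)"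
    unfolding set_lebesgue_integral_def f_eq by simp
  also have "\<dots> = wright_transform \<beta> k t"
    unfolding V_def wright_transform_eq(2)[OF k exp_k t] by (rule caputo_integral_eq(2)[OF t k k_bound])
  finally show ?thesis
    using t by (simp add: caputo_def right_ext_def f_def integral_open_interval_real)
qed

lemma wright_transform_sum:
  assumes "finite A" and t: "t > 0"
    and h: "\<And>i. i \<in> A \<Longrightarrow> continuous_on {0..} (h i)" "\<And>i. i \<in> A \<Longrightarrow> exp_order (h i)"
    and F: "\<And>x. x \<ge> 0 \<Longrightarrow> (\<Sum>i\<in>A. c i * h i x) = F x"
  shows "(\<Sum>i\<in>A. c i * wright_transform \<beta> (h i) t) = wright_transform \<beta> F t"
proof -
  have int: "(\<lambda>s. wright_g \<beta> s t * h i s) integrable_on {0..}" if "i \<in> A" for i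
    using wright_transform_eq(1)[OF h(1)[OF that] h(2)[OF that] t] by (rule set_borel_integral_eq_integral(1))
  have "(\<Sum>i\<in>A. c i * wright_transform \<beta> (h i) t) = (\<Sum>i\<in>A. integral {0..} (\<lambda>s. c i * (wright_g \<beta> s t * h i s)))"
    using t by (simp add: wright_transform_def right_ext_def)
  also have "\<dots> = integral {0..} (\<lambda>s. \<Sum>i\<in>A. c i * (wright_g \<beta> s t * h i s))"
    using int assms(1) by (intro integral_sum[symmetric] integrable_on_mult_right) auto
  also have "\<dots> = integral {0..} (\<lambda>s. wright_g \<beta> s t * F s)"
    by (rule integral_cong) (simp add: F[symmetric] sum_distrib_left mult_ac)
  finally show ?thesis using t by (simp add: wright_transform_def right_ext_def)
qed

end

section \<open>From the ordinary to the fractional equation\<close>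

theorem theorem1:
  fixes \<beta> :: real and n :: nat and a :: "nat \<Rightarrow> real" and F :: "real \<Rightarrow> real"
    and Z :: "nat \<Rightarrow> real \<Rightarrow> real" and zs :: "nat \<Rightarrow> real"
  assumes beta: "0 < \<beta>" "\<beta> < 1"
    and n: "n \<ge> 1"
    and F_cont: "continuous_on {0..} F" and F_exp: "exp_order F"
    and Z_deriv: "\<And>k t. k < n \<Longrightarrow> t \<ge> 0 \<Longrightarrow>
                    (Z k has_real_derivative Z (Suc k) t) (at t within {0..})"
    and Z_cont: "\<And>k. k \<le> n \<Longrightarrow> continuous_on {0..} (Z k)"
    and ode: "\<And>t. t \<ge> 0 \<Longrightarrow> (\<Sum>k=1..n. a k * Z k t) + a 0 * Z 0 t = F t"
    and init: "\<And>k. k < n \<Longrightarrow> Z k 0 = zs k"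
    and Z_exp: "\<And>k. k \<le> n \<Longrightarrow> exp_order (Z k)"
    and cap_exists: "\<And>k. 1 \<le> k \<Longrightarrow> k \<le> n \<Longrightarrow>
                       caputo_exists \<beta> ((caputo \<beta> ^^ (k - 1)) (wright_transform \<beta> (Z 0)))"
    and cap_cont: "\<And>k. 1 \<le> k \<Longrightarrow> k \<le> n \<Longrightarrow>
                     continuous_on {0..} ((caputo \<beta> ^^ k) (wright_transform \<beta> (Z 0)))"
    and cap_exp: "\<And>k. 1 \<le> k \<Longrightarrow> k \<le> n \<Longrightarrow>
                    exp_order ((caputo \<beta> ^^ k) (wright_transform \<beta> (Z 0)))"
    and cap_init: "\<And>k. k \<le> n \<Longrightarrow>
                     (caputo \<beta> ^^ k) (wright_transform \<beta> (Z 0)) 0 = Z k 0"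
  shows "(\<forall>t>0. (\<Sum>k=1..n. a k * (caputo \<beta> ^^ k) (wright_transform \<beta> (Z 0)) t)
                 + a 0 * wright_transform \<beta> (Z 0) t = wright_transform \<beta> F t)
       \<and> (\<forall>k<n. (caputo \<beta> ^^ k) (wright_transform \<beta> (Z 0)) 0 = zs k)"
proof (intro conjI allI impI)
  \<comment> \<open>The induction concerns t > 0 only; the values at 0 are obtained separately from
    \<open>cap_init\<close> and \<open>init\<close>.\<close>
  have iterate: "(caputo \<beta> ^^ k) (wright_transform \<beta> (Z 0)) t = wright_transform \<beta> (Z k) t"
    if "k \<le> n" "t > 0" for k t
    using that
  proof (induction k arbitrary: t)
    case (Suc k)
    have "caputo \<beta> ((caputo \<beta> ^^ k) (wright_transform \<beta> (Z 0))) t = wright_transform \<beta> (Z (Suc k)) t"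
      using Suc by (intro caputo_wright_transform[OF beta, where h = "Z k"] Z_deriv Z_cont Z_exp) auto
    then show ?case by simp
  qed simp
  fix t :: real assume t: "t > 0"
  have split: "(\<Sum>k=0..n. f k) = (\<Sum>k=1..n. f k) + f 0" for f :: "nat \<Rightarrow> real"
    by (simp add: sum.atLeast_Suc_atMost)
  have "(\<Sum>k=0..n. a k * wright_transform \<beta> (Z k) t) = wright_transform \<beta> F t"
    using Z_cont Z_exp ode t by (intro wright_transform_sum[OF beta]) (auto simp: split)
  then show "(\<Sum>k=1..n. a k * (caputo \<beta> ^^ k) (wright_transform \<beta> (Z 0)) t)
      + a 0 * wright_transform \<beta> (Z 0) t = wright_transform \<beta> F t"
    unfolding split using iterate[OF _ t] by simp
next
  fix k assume "k < n"
  then show "(caputo \<beta> ^^ k) (wright_transform \<beta> (Z 0)) 0 = zs k"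
    using cap_init[of k] init[of k] by simp
qed

end
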